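(* Let $p\geq 3$ be an odd integer, $v_0=1$ and $v_i\in\{-1,1\}$ for $i=1,\dots,p-1$. Let $P(z)=v_0+v_1z+\cdots+v_{p-1}z^{p-1}$ and $f_p(z)=\prod_{i=0}^{\infty}P(z^{p^i})$. Assume that $b\geq 2$ is an integer such that $P(1/b^{p^i})\neq 0$ for all integers $i\geq 0$. For $m\geq p$ define $v_m:=v_i$ where $m\equiv i\pmod p$ and $0\leq i<p$. If \[\frac{v_j+v_{j+1}-v_{2j+1}-v_{2j+2}}{2}\equiv 1\pmod 2\quad\text{for all } 0\leq j\leq p-2,\] then the real number $f_p(1/b)$ is transcendental and its irrationality exponent is equal to $2$.
   Context: The irrationality exponent of an irrational real number $\xi$ is the supremum of the real numbers $\nu$ such that $|\xi-r/s|<s^{-\nu}$ holds for infinitely many pairs $(r,s)\in\mathbb{Z}\times\mathbb{N}$. *)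

theory Defs
  imports "HOL-Analysis.Analysis" "HOL-Number_Theory.Cong"
begin

definition P_fun :: "nat \<Rightarrow> (nat \<Rightarrow> int) \<Rightarrow> real \<Rightarrow> real" where
  "P_fun p v z = (\<Sum>i<p. of_int (v i) * z ^ i)"

definition f_prod :: "nat \<Rightarrow> (nat \<Rightarrow> int) \<Rightarrow> real \<Rightarrow> real" where
  "f_prod p v z = (\<Prod>i. P_fun p v (z ^ (p ^ i)))"

text \<open>
  The supremum is taken in the extended reals, as it is infinite for Liouville numbers.
  The notion is meant for irrational \<open>\<xi>\<close> only; the pairs \<open>(r, s)\<close> need not be coprime.
\<close>
definition irrationality_exponent :: "real \<Rightarrow> ereal" where
  "irrationality_exponent \<xi> =
     Sup {ereal \<nu> | \<nu>.
       infinite {(r :: int, s :: nat). s > 0 \<and> \<bar>\<xi> - of_int r / of_nat s\<bar> < of_nat s powr (- \<nu>)}}"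

end

theory Submission
  imports Defs "HOL-Library.Z2" "HOL-Computational_Algebra.Formal_Laurent_Series"
    "HOL-Computational_Algebra.Fundamental_Theorem_Algebra"
begin

text \<open>
  The coefficients \<open>c\<close> of the power series \<open>f(z) = P(z) f(z\<^sup>p)\<close> are \<open>\<plusminus>1\<close>, and the congruence on \<open>v\<close>
  propagates to \<open>c n * c (n + 1) * c (2 n + 1) * c (2 n + 2) = -1\<close> for all \<open>n\<close>. Modulo 2, the sequence
  \<open>e n = (c n - c (n + 2)) / 2\<close> therefore satisfies \<open>e = 1 + z\<^sup>2 e\<^sup>2 + (z + z\<^sup>2) h\<^sup>2\<close>. Multiplying by \<open>q\<^sup>2\<close> and
  differentiating shows that no polynomial \<open>q\<close> of degree \<open>n\<close> makes \<open>q e\<close> vanish at all degrees from \<open>n\<close> to \<open>2 n\<close>,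
  so \<open>f\<close> has no Pade approximants of abnormally high order.

  Irrationality exponent: the Pade approximants of \<open>f\<close>, evaluated at \<open>b\<close> to the power \<open>-p\<^sup>k\<close> and transported to \<open>1/b\<close> by the
  functional equation, are rational approximations of \<open>f(1/b)\<close> that are nearly optimal, and their
  denominators are so dense that no other rational number can approximate \<open>f(1/b)\<close> much better.

  Transcendence: an algebraic relation of least degree \<open>D\<close> for \<open>f\<close> over the rational functions makes \<open>f\<^sup>D\<close>
  rational; comparing orders of vanishing at \<open>w\<close> and \<open>w\<^sup>p\<close> makes \<open>f\<close> itself rational, which is impossible.
  Mahler's method, with a polynomial in \<open>z\<close> and \<open>f\<close> vanishing to high order at 0, then shows that \<open>f(1/b)\<close> is
  transcendental.
\<close>

section \<open>Linear algebra and series over the two-element field\<close>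

text \<open>Elimination without division: replacing the coefficients by 2 by 2 minors turns the
  bound \<open>H\<close> into \<open>2 * H\<^sup>2\<close>, and induction over the equations
  follows. The bound is cruder than that of Siegel's lemma, but its exponent depends only on the
  number of equations, which is what \<open>algebraic_lower_bound\<close> exploits.\<close>

lemma homogeneous_system:
  fixes a :: "'i \<Rightarrow> 'j \<Rightarrow> int" and H :: int
  assumes "finite I" "finite J" "card I < card J" "card J \<le> n" "H \<ge> 1"
    and "\<And>i j. i \<in> I \<Longrightarrow> j \<in> J \<Longrightarrow> \<bar>a i j\<bar> \<le> H"
  shows "\<exists>x. (\<exists>j\<in>J. x j \<noteq> 0) \<and> (\<forall>j\<in>J. \<bar>x j\<bar> \<le> (2 * int n * H) ^ (3 ^ card I)) \<and>
             (\<forall>i\<in>I. (\<Sum>j\<in>J. a i j * x j) = 0)"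
  using assms
proof (induction I arbitrary: J a H rule: finite_induct)
  case empty
  then obtain k where "k \<in> J" by fastforce
  moreover from empty have "1 \<le> 2 * int n * H"
    by (smt (verit, best) card.empty mult_le_cancel_left1 of_nat_0_less_iff less_le_trans)
  ultimately show ?case by (intro exI[of _ "\<lambda>_. 1"]) auto
next
  case (insert i I)
  have n1: "int n \<ge> 1" using insert.prems by auto
  define W where "W = 2 * int n * H"
  have "H \<le> int n * H" using n1 insert.prems(4) mult_right_mono[of 1 "int n" H] by simp
  then have W: "W \<ge> 1" "W \<ge> int n * H" "H \<le> W"
    using insert.prems(4) unfolding W_def mult.assoc by linarith+
  show ?case
  proof (cases "\<forall>j\<in>J. a i j = 0")
    case True
    have "\<exists>x. (\<exists>j\<in>J. x j \<noteq> 0) \<and> (\<forall>j\<in>J. \<bar>x j\<bar> \<le> (2 * int n * H) ^ (3 ^ card I)) \<and>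
             (\<forall>i\<in>I. (\<Sum>j\<in>J. a i j * x j) = 0)"
      using insert by (intro insert.IH) auto
    then obtain x where x: "\<exists>j\<in>J. x j \<noteq> 0" "\<And>j. j \<in> J \<Longrightarrow> \<bar>x j\<bar> \<le> W ^ (3 ^ card I)"
             "\<And>i. i \<in> I \<Longrightarrow> (\<Sum>j\<in>J. a i j * x j) = 0" unfolding W_def by blast
    have "W ^ (3 ^ card I) \<le> W ^ (3 ^ card (insert i I))"
      using W(1) insert by (intro power_increasing) auto
    then show ?thesis using x True unfolding W_def
      by (intro exI[of _ x]) (auto intro: order_trans)
  next
    case False
    then obtain k where k: "k \<in> J" "a i k \<noteq> 0" by blast
    define J' where "J' = J - {k}"
    define a' where "a' = (\<lambda>i' j. a i k * a i' j - a i' k * a i j)"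
    have J': "finite J'" "card I < card J'" "card J' \<le> n" "J' \<subseteq> J" "k \<notin> J'" "J = insert k J'"
      using insert k unfolding J'_def by (auto simp: card_Diff_singleton_if)
    have bd: "\<bar>a' i' j\<bar> \<le> 2 * H\<^sup>2" if "i' \<in> I" "j \<in> J'" for i' j
    proof -
      have "\<bar>a i k * a i' j\<bar> \<le> H * H" "\<bar>a i' k * a i j\<bar> \<le> H * H"
        unfolding abs_mult using that J'(4) k insert.prems(4,5)
        by (auto intro!: mult_mono)
      then show ?thesis unfolding a'_def power2_eq_square by linarith
    qed
    have "\<exists>x. (\<exists>j\<in>J'. x j \<noteq> 0) \<and> (\<forall>j\<in>J'. \<bar>x j\<bar> \<le> (2 * int n * (2 * H\<^sup>2)) ^ (3 ^ card I)) \<and>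
             (\<forall>i\<in>I. (\<Sum>j\<in>J'. a' i j * x j) = 0)"
      using J' bd one_le_power[OF insert.prems(4), of 2] by (intro insert.IH) auto
    then obtain x where x: "\<exists>j\<in>J'. x j \<noteq> 0"
        "\<And>j. j \<in> J' \<Longrightarrow> \<bar>x j\<bar> \<le> (2 * int n * (2 * H\<^sup>2)) ^ (3 ^ card I)"
        "\<And>i. i \<in> I \<Longrightarrow> (\<Sum>j\<in>J'. a' i j * x j) = 0" by blast
    define B where "B = W ^ (2 * 3 ^ card I)"
    have W2: "2 * int n * (2 * H\<^sup>2) \<le> W\<^sup>2"
    proof -
      have "int n * H\<^sup>2 \<le> (int n)\<^sup>2 * H\<^sup>2" using n1 by (intro mult_right_mono) (auto simp: power2_eq_square)
      then show ?thesis unfolding W_def by (simp add: power2_eq_square algebra_simps)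
    qed
    have xB: "\<bar>x j\<bar> \<le> B" if "j \<in> J'" for j
    proof -
      have "\<bar>x j\<bar> \<le> (2 * int n * (2 * H\<^sup>2)) ^ (3 ^ card I)" by (rule x(2)[OF that])
      also have "\<dots> \<le> (W\<^sup>2) ^ (3 ^ card I)" using W2 insert.prems(4) by (intro power_mono) auto
      finally show ?thesis unfolding B_def by (simp add: power_mult)
    qed
    have B1: "B \<ge> 1" unfolding B_def using W(1) by simp
    \<comment> \<open>Recovering the eliminated unknown costs one more factor \<open>W\<close>; with
      \<open>m = card I\<close> it fits because \<open>1 + 2 * 3 ^ m\<close> is at most
      \<open>3 ^ (m + 1)\<close>.\<close>
    have WB: "W * B \<le> W ^ (3 ^ card (insert i I))"
    proof -
      have "W * B = W ^ (1 + 2 * 3 ^ card I)" unfolding B_def by simp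
      also have "\<dots> \<le> W ^ (3 ^ card (insert i I))"
        using W(1) insert by (intro power_increasing) auto
      finally show ?thesis .
    qed
    \<comment> \<open>The other unknowns are scaled by the pivot \<open>a i k\<close>, so that
      equation \<open>i\<close> can be solved for unknown \<open>k\<close> in integers.\<close>
    define y where "y = (\<lambda>j. if j = k then - (\<Sum>j\<in>J'. a i j * x j) else a i k * x j)"
    have yJ': "y j = a i k * x j" if "j \<in> J'" for j using that J'(5) unfolding y_def by auto
    have 1: "\<exists>j\<in>J. y j \<noteq> 0" using x(1) k(2) yJ' J'(4) by (metis mult_eq_0_iff subsetD)
    have 2: "\<bar>y j\<bar> \<le> W * B" if "j \<in> J" for j
    proof (cases "j = k")
      case True
      have "\<bar>y j\<bar> \<le> (\<Sum>j\<in>J'. \<bar>a i j * x j\<bar>)" unfolding y_def using True by simp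
      also have "\<dots> \<le> (\<Sum>j\<in>J'. H * B)" unfolding abs_mult
        using xB insert.prems(4,5) J'(4) by (intro sum_mono mult_mono) auto
      also have "\<dots> \<le> int n * (H * B)"
        using J'(3) B1 insert.prems(4) by (simp add: mult_right_mono)
      also have "\<dots> \<le> W * B" using W(2) B1 by (simp add: mult.assoc[symmetric] mult_right_mono)
      finally show ?thesis .
    next
      case False
      then have "j \<in> J'" using that J'(6) by auto
      then have "\<bar>y j\<bar> = \<bar>a i k\<bar> * \<bar>x j\<bar>" by (simp add: yJ' abs_mult)
      also have "\<dots> \<le> W * B" using xB[OF \<open>j \<in> J'\<close>] W insert.prems(4) insert.prems(5)[of i k] k by (intro mult_mono) auto
      finally show ?thesis .
    qed
    have S: "(\<Sum>j\<in>J. a i' j * y j) = a i' k * y k + (\<Sum>j\<in>J'. a i' j * (a i k * x j))" for i'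
      unfolding J'(6) using J'(1,5) by (simp add: yJ')
    have 3: "(\<Sum>j\<in>J. a i' j * y j) = 0" if "i' \<in> insert i I" for i'
    proof (cases "i' = i")
      case True
      show ?thesis unfolding S True by (simp add: y_def sum_distrib_left mult_ac)
    next
      case False
      then have "i' \<in> I" using that by auto
      have "(\<Sum>j\<in>J. a i' j * y j) = (\<Sum>j\<in>J'. a' i' j * x j)"
        unfolding S by (simp add: y_def a'_def sum_distrib_left sum_subtractf algebra_simps)
      then show ?thesis using x(3)[OF \<open>i' \<in> I\<close>] by simp
    qed
    show ?thesis using 1 2 3 WB unfolding W_def
      by (intro exI[of _ y]) (auto intro: order_trans)
  qed
qed

section \<open>Power series over the two-element field\<close>

text \<open>Frobenius in characteristic 2: in the Cauchy product the terms at \<open>i\<close> and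
  \<open>n - i\<close> cancel, which leaves the middle term, the square of a bit and hence the bit
  itself.\<close>

lemma fps_square_bit:
  fixes f :: "bit fps"
  shows "fps_nth (f * f) n = (if even n then fps_nth f (n div 2) else 0)"
proof -
  define g where "g = (\<lambda>i. fps_nth f i * fps_nth f (n - i))"
  define L where "L = {i. i \<le> n \<and> 2 * i < n}"
  define U where "U = {i. i \<le> n \<and> 2 * i > n}"
  define M where "M = {i. 2 * i = n}"
  have fin: "finite L" "finite U" "finite M"
    unfolding L_def U_def M_def by (auto intro: finite_subset[of _ "{..n}"])
  have "fps_nth (f * f) n = sum g {0..n}" by (simp add: fps_mult_nth g_def)
  also have "{0..n} = L \<union> (U \<union> M)" unfolding L_def U_def M_def by auto
  also have "sum g \<dots> = sum g L + (sum g U + sum g M)"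
    using fin by (subst sum.union_disjoint, (auto simp: L_def U_def M_def)[3])
       (subst sum.union_disjoint, auto simp: L_def U_def M_def)
  also have "sum g U = sum g L"
    by (rule sum.reindex_bij_witness[of _ "\<lambda>i. n - i" "\<lambda>i. n - i"])
       (auto simp: L_def U_def g_def mult.commute)
  also have "sum g L + (sum g L + sum g M) = sum g M"
    by (cases "sum g L"; cases "sum g M") simp_all
  also have "sum g M = (if even n then fps_nth f (n div 2) else 0)"
  proof (cases "even n")
    case True
    then have "M = {n div 2}" "n - n div 2 = n div 2" unfolding M_def by auto
    then show ?thesis using True by (cases "fps_nth f (n div 2)") (auto simp: g_def)
  next
    case False
    then have "M = {}" unfolding M_def by auto
    then show ?thesis using False by simp
  qed
  finally show ?thesis .
qed

lemma fps_bit_add_self [simp]: "f + f = (0 :: bit fps)"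
  by (rule fps_ext) (simp flip: mult_2)

text \<open>The \<open>n + 1\<close> conditions on the \<open>n + 1\<close> coefficients of
  \<open>q\<close> form a square system, so this is the nonvanishing of the Hankel determinants of
  \<open>e\<close>. The induction on \<open>n\<close> shows that the top coefficient of
  \<open>q\<close> vanishes and that the window of zeros of \<open>q * e\<close> extends one step
  down.\<close>

lemma bit_series_perfect_profile:
  fixes e h q :: "bit fps"
  assumes e: "e = 1 + fps_X\<^sup>2 * (e * e) + (fps_X + fps_X\<^sup>2) * (h * h)"
    and "\<And>i. i > n \<Longrightarrow> fps_nth q i = 0"
    and "\<And>i. n \<le> i \<Longrightarrow> i \<le> 2 * n \<Longrightarrow> fps_nth (q * e) i = 0"
  shows "q = 0"
  using assms(2,3)
proof (induction n)
  case 0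
  have "fps_nth e 0 = 1" by (subst e) simp
  then have "fps_nth q 0 = 0" using 0(2)[of 0] by simp
  then show ?case using 0(1) by (intro fps_ext) (metis fps_zero_nth neq0_conv)
next
  case (Suc m)
  define w where "w = q * e"
  define u where "u = q * w"
  have sq: "fps_deriv (f * f) = 0" for f :: "bit fps"
    by (simp add: mult.commute)
  \<comment> \<open>In characteristic 2 squares have derivative 0, so differentiating \<open>u\<close> eliminates \<open>h\<close>. The top
    coefficients then satisfy \<open>x + y + x y = 0\<close>, which forces both to vanish.\<close>
  have "u = q * (q * (1 + fps_X\<^sup>2 * (e * e) + (fps_X + fps_X\<^sup>2) * (h * h)))"
    unfolding u_def w_def using e by simp
  also have "\<dots> = q * q + (fps_X * w) * (fps_X * w) + (fps_X + fps_X\<^sup>2) * ((q * h) * (q * h))"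
    unfolding w_def by (simp add: algebra_simps power2_eq_square)
  finally have u: "u = q * q + (fps_X * w) * (fps_X * w) + (fps_X + fps_X\<^sup>2) * ((q * h) * (q * h))" .
  have dX: "fps_deriv (fps_X + fps_X\<^sup>2 :: bit fps) = 1"
    using sq[of fps_X] by (simp add: power2_eq_square)
  have "fps_deriv u = (q * h) * (q * h)"
    by (subst u, subst fps_deriv_add, subst fps_deriv_add, subst (3) fps_deriv_mult, unfold sq dX) simp
  with u have "u = q * q + (fps_X * w) * (fps_X * w) + (fps_X * fps_deriv u + fps_X * (fps_X * fps_deriv u))"
    by (simp add: algebra_simps power2_eq_square)
  then have "fps_nth u (2 * Suc m) = fps_nth (q * q) (2 * Suc m) + fps_nth ((fps_X * w) * (fps_X * w)) (2 * Suc m)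
      + (fps_nth (fps_X * fps_deriv u) (2 * Suc m) + fps_nth (fps_X * (fps_X * fps_deriv u)) (2 * Suc m))"
    by (metis fps_add_nth)
  also have "fps_nth (q * q) (2 * Suc m) = fps_nth q (Suc m)"
    unfolding fps_square_bit by simp
  also have "fps_nth ((fps_X * w) * (fps_X * w)) (2 * Suc m) = fps_nth w m"
    unfolding fps_square_bit by simp
  also have "fps_nth (fps_X * fps_deriv u) (2 * Suc m) = of_nat (2 * Suc m) * fps_nth u (2 * Suc m)"
    by simp
  also have "of_nat (2 * Suc m) = (0 :: bit)" unfolding of_nat_mult by simp
  also have "fps_nth (fps_X * (fps_X * fps_deriv u)) (2 * Suc m) = of_nat (2 * m + 1) * fps_nth u (m + Suc m)"
    by (simp add: mult_2)
  also have "of_nat (2 * m + 1) = (1 :: bit)" unfolding of_nat_add of_nat_mult by simp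
  also have "fps_nth u (2 * Suc m) = 0"
    unfolding u_def fps_mult_nth
  proof (intro sum.neutral ballI)
    fix i assume "i \<in> {0..2 * Suc m}"
    then show "fps_nth q i * fps_nth w (2 * Suc m - i) = 0"
      using Suc.prems(1)[of i] Suc.prems(2)[of "2 * Suc m - i"] unfolding w_def
      by (cases "i > Suc m") auto
  qed
  \<comment> \<open>In degree \<open>2 * m + 1\<close> exactly one product escapes both the degree
    bound on \<open>q\<close> and the zeros of \<open>w\<close>.\<close>
  also have "fps_nth u (m + Suc m) = (\<Sum>i\<in>{Suc m}. fps_nth q i * fps_nth w (m + Suc m - i))"
    unfolding u_def fps_mult_nth
  proof (rule sum.mono_neutral_right)
    show "\<forall>i\<in>{0..m + Suc m} - {Suc m}. fps_nth q i * fps_nth w (m + Suc m - i) = 0"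
    proof
      fix i assume "i \<in> {0..m + Suc m} - {Suc m}"
      then show "fps_nth q i * fps_nth w (m + Suc m - i) = 0"
        using Suc.prems(1)[of i] Suc.prems(2)[of "m + Suc m - i"] unfolding w_def
        by (cases "i > Suc m") auto
    qed
  qed auto
  also have "\<dots> = fps_nth q (Suc m) * fps_nth w m"
    by (simp only: sum.insert sum.empty finite.emptyI empty_iff not_False_eq_True add_0_right add_diff_cancel_right')
  finally have "fps_nth q (Suc m) + fps_nth w m + fps_nth q (Suc m) * fps_nth w m = 0"
    by simp
  then have z: "fps_nth q (Suc m) = 0" "fps_nth w m = 0"
    by (cases "fps_nth q (Suc m)"; cases "fps_nth w m"; simp)+
  show ?case
  proof (rule Suc.IH)
    fix i assume "m < i" then show "fps_nth q i = 0"
      using z(1) Suc.prems(1)[of i] by (cases "i = Suc m") auto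
  next
    fix i assume "m \<le> i" "i \<le> 2 * m"
    then show "fps_nth (q * e) i = 0"
      using z(2) Suc.prems(2)[of i] by (cases "i = m") (auto simp: w_def)
  qed
qed

section \<open>Images of integer power series over other rings\<close>

definition fps_of_int_fps :: "int fps \<Rightarrow> 'a :: comm_ring_1 fps" where
  "fps_of_int_fps f = Abs_fps (\<lambda>n. of_int (fps_nth f n))"

lemma fps_nth_of_int_fps [simp]: "fps_nth (fps_of_int_fps f) n = of_int (fps_nth f n)"
  by (simp add: fps_of_int_fps_def)

lemma fps_of_int_fps_add: "fps_of_int_fps (f + g) = fps_of_int_fps f + fps_of_int_fps g"
  by (rule fps_ext) simp

lemma fps_of_int_fps_mult: "fps_of_int_fps (f * g) = fps_of_int_fps f * fps_of_int_fps g"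
  by (rule fps_ext) (simp add: fps_mult_nth)

lemma fps_of_int_fps_0: "fps_of_int_fps 0 = 0"
  by (rule fps_ext) simp

lemma fps_of_int_fps_1: "fps_of_int_fps 1 = 1"
  by (rule fps_ext) simp

lemma fps_of_int_fps_power: "fps_of_int_fps (f ^ n) = fps_of_int_fps f ^ n"
  by (induction n) (simp_all add: fps_of_int_fps_1 fps_of_int_fps_mult)

lemma fps_of_int_fps_sum: "fps_of_int_fps (\<Sum>i\<in>A. f i) = (\<Sum>i\<in>A. fps_of_int_fps (f i))"
  by (induction A rule: infinite_finite_induct) (simp_all add: fps_of_int_fps_0 fps_of_int_fps_add)

lemma fps_of_int_fps_of_poly: "fps_of_int_fps (fps_of_poly q) = fps_of_poly (map_poly of_int q)"
  by (rule fps_ext) (simp add: coeff_map_poly)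

lemma of_int_bit_eq: "of_int k = (if even k then 0 else 1 :: bit)"
proof -
  have "(of_int k :: bit) = of_int (2 * (k div 2) + k mod 2)" by simp
  also have "\<dots> = of_int (k mod 2)" unfolding of_int_add of_int_mult by simp
  finally show ?thesis by (cases "even k") (auto simp: odd_iff_mod_2_eq_one)
qed

section \<open>Sign sequences without good rational approximations\<close>

text \<open>For four signs \<open>w, x, y, z\<close> the number \<open>(w + x - y - z) / 2\<close>
  is odd exactly when their product is \<open>-1\<close>, so \<open>c_prod\<close> is the congruence
  of the theorem in multiplicative form. With \<open>c 0 = 1\<close> such sequences are known as
  apwenian.\<close>

locale apwenian =
  fixes c :: "nat \<Rightarrow> int"
  assumes c_abs: "c n \<in> {-1, 1}"
    and c_prod: "c n * c (n + 1) * c (2 * n + 1) * c (2 * n + 2) = -1"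
begin

text \<open>Up to the factor \<open>-2\<close>, a shift by two and the first two terms, this is
  \<open>(1 - z\<^sup>2) f(z)\<close>. The division is exact, as signs are odd. Unlike
  \<open>f\<close>, which is constant modulo 2 coefficientwise, \<open>e\<close> retains information
  modulo 2.\<close>

definition e :: "int fps" where "e = Abs_fps (\<lambda>n. (c n - c (n + 2)) div 2)"

lemma e_nth: "2 * fps_nth e n = c n - c (n + 2)"
proof -
  have "c n = -1 \<or> c n = 1" "c (n + 2) = -1 \<or> c (n + 2) = 1" using c_abs by auto
  then show ?thesis unfolding e_def by auto
qed

text \<open>The number \<open>e k\<close> is odd exactly when \<open>c k * c (k + 2) = -1\<close>.
  Multiplying \<open>c_prod\<close> at \<open>n\<close> and at \<open>n + 1\<close> cancels the
  square of \<open>c (n + 1)\<close> and pairs the remaining six signs into three such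
  products.\<close>

lemma e_rec: "even (fps_nth e n + fps_nth e (2 * n + 1) + fps_nth e (2 * n + 2))"
proof -
  have s: "c k = -1 \<or> c k = 1" for k using c_abs by auto
  have "c n * c (n + 1) * c (2 * n + 1) * c (2 * n + 2) = -1"
    "c (n + 1) * c (n + 2) * c (2 * n + 3) * c (2 * n + 4) = -1"
    using c_prod[of n] c_prod[of "n + 1"] by (simp_all add: eval_nat_numeral)
  then show ?thesis
    using s[of n] s[of "n + 1"] s[of "n + 2"] s[of "2 * n + 1"] s[of "2 * n + 2"] s[of "2 * n + 3"] s[of "2 * n + 4"]
    by (auto simp: e_def eval_nat_numeral)
qed

lemma e_0: "odd (fps_nth e 0)"
proof -
  have s: "c k = -1 \<or> c k = 1" for k using c_abs by auto
  show ?thesis using c_prod[of 0] s[of 0] s[of 1] s[of 2] by (auto simp: e_def numeral_2_eq_2)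
qed

text \<open>The series \<open>h\<close> collects the coefficients of odd index. By
  \<open>fps_square_bit\<close>, the term \<open>fps_X * (h * h)\<close> reproduces them, while the
  two terms with \<open>fps_X\<^sup>2\<close> give the even coefficients through
  \<open>e_rec\<close>.\<close>

lemma e_bit:
  fixes eb h :: "bit fps"
  defines "eb \<equiv> fps_of_int_fps e"
  defines "h \<equiv> Abs_fps (\<lambda>n. fps_nth eb (2 * n + 1))"
  shows "eb = 1 + fps_X\<^sup>2 * (eb * eb) + (fps_X + fps_X\<^sup>2) * (h * h)"
proof -
  have rec: "fps_nth eb (2 * n + 2) = fps_nth eb n + fps_nth eb (2 * n + 1)" for n
    using e_rec[of n] unfolding eb_def fps_nth_of_int_fps of_int_bit_eq by auto
  have e0: "fps_nth eb 0 = 1" using e_0 unfolding eb_def fps_nth_of_int_fps of_int_bit_eq by simp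
  have [simp]: "fps_nth (fps_X\<^sup>2 * f) n = (if n < 2 then 0 else fps_nth f (n - 2))" for f :: "bit fps" and n
    by (rule fps_X_power_mult_nth)
  show ?thesis
  proof (rule fps_ext)
    fix n :: nat
    consider "n = 0" | "n = 1" | k where "n = 2 * k + 2" | k where "n = 2 * k + 3"
    proof -
      have "n = 0 \<or> n = 1 \<or> n = 2 * ((n - 2) div 2) + 2 \<or> n = 2 * ((n - 2) div 2) + 3" by presburger
      then show ?thesis using that by blast
    qed
    then show "fps_nth eb n = fps_nth (1 + fps_X\<^sup>2 * (eb * eb) + (fps_X + fps_X\<^sup>2) * (h * h)) n"
    proof cases
      case 3
      have "fps_nth (1 + fps_X\<^sup>2 * (eb * eb) + (fps_X + fps_X\<^sup>2) * (h * h)) n = fps_nth eb k + fps_nth h k"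
        unfolding 3 distrib_right fps_add_nth by (simp add: fps_square_bit)
      then show ?thesis unfolding 3 rec by (simp add: h_def)
    next
      case 4
      have "2 * k + 3 - Suc 0 = 2 * (k + 1)" by simp
      then have "fps_nth (1 + fps_X\<^sup>2 * (eb * eb) + (fps_X + fps_X\<^sup>2) * (h * h)) n = fps_nth h (Suc k)"
        unfolding 4 distrib_right fps_add_nth by (simp add: fps_square_bit)
      then show ?thesis unfolding 4 by (simp add: h_def eval_nat_numeral)
    qed (simp_all add: e0 distrib_right fps_square_bit, simp add: h_def)
  qed
qed

definition f :: "int fps" where "f = Abs_fps c"

text \<open>For \<open>i > n\<close>, coefficient \<open>i\<close> of \<open>q * e\<close> is
  determined by coefficients \<open>i\<close> and \<open>i + 2\<close> of \<open>q * f\<close>. The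
  window of zeros therefore shrinks from \<open>n < i < 2 * n + 5\<close> to
  \<open>n < i < 2 * n + 3\<close>, which is the window of \<open>bit_series_perfect_profile\<close>
  for \<open>n + 1\<close>.\<close>

lemma even_denominator:
  fixes q :: "int fps"
  assumes "\<And>i. i > n \<Longrightarrow> fps_nth q i = 0"
    and "\<And>i. n < i \<Longrightarrow> i < 2 * n + 5 \<Longrightarrow> fps_nth (q * f) i = 0"
  shows "even (fps_nth q i)"
proof -
  have fe: "f + 2 * (fps_X\<^sup>2 * e) = fps_const (c 0) + fps_const (c 1) * fps_X + fps_X\<^sup>2 * f"
  proof (rule fps_ext)
    fix n
    show "fps_nth (f + 2 * (fps_X\<^sup>2 * e)) n = fps_nth (fps_const (c 0) + fps_const (c 1) * fps_X + fps_X\<^sup>2 * f) n"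
    proof -
      have "Suc (Suc (n - 2)) = n" if "\<not> n < 2" using that by simp
      then show ?thesis using e_nth[of "n - 2"]
        by (cases "n < 2") (auto simp: fps_X_power_mult_nth f_def less_2_cases_iff numeral_fps_const)
    qed
  qed
  have qe: "fps_nth (q * e) i = 0" if "n < i" "i < 2 * n + 3" for i
  proof -
    have "q * f + 2 * (fps_X\<^sup>2 * (q * e)) = fps_const (c 0) * q + fps_const (c 1) * (fps_X * q) + fps_X\<^sup>2 * (q * f)"
      using arg_cong[OF fe, of "\<lambda>x. q * x"] by (simp add: algebra_simps)
    then have "fps_nth (q * f + 2 * (fps_X\<^sup>2 * (q * e))) (i + 2) =
       fps_nth (fps_const (c 0) * q + fps_const (c 1) * (fps_X * q) + fps_X\<^sup>2 * (q * f)) (i + 2)" by simp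
    then show ?thesis using assms(2)[of "i + 2"] assms(2)[of i] assms(1) that
      by (simp add: fps_X_power_mult_nth)
  qed
  have "(fps_of_int_fps q :: bit fps) = 0"
  proof (rule bit_series_perfect_profile[OF e_bit, where n = "n + 1"])
    fix i assume "n + 1 < i" then show "fps_nth (fps_of_int_fps q) i = (0 :: bit)"
      using assms(1) by simp
  next
    fix i assume "n + 1 \<le> i" "i \<le> 2 * (n + 1)"
    then show "fps_nth (fps_of_int_fps q * fps_of_int_fps e) i = (0 :: bit)"
      using qe[of i] by (simp flip: fps_of_int_fps_mult)
  qed
  then have "(of_int (fps_nth q i) :: bit) = 0" by (metis fps_nth_of_int_fps fps_zero_nth)
  then show ?thesis unfolding of_int_bit_eq by (auto split: if_splits)
qed

text \<open>Infinite descent: a solution has even coefficients, its half is again a solution, and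
  the sum of the absolute values drops unless the solution is 0.\<close>

lemma badly_approximable:
  fixes q :: "int fps"
  assumes "\<And>i. i > n \<Longrightarrow> fps_nth q i = 0"
    and "\<And>i. n < i \<Longrightarrow> i < 2 * n + 5 \<Longrightarrow> fps_nth (q * f) i = 0"
  shows "q = 0"
  using assms
proof (induction "\<Sum>i\<le>n. nat \<bar>fps_nth q i\<bar>" arbitrary: q rule: less_induct)
  case less
  define q' where "q' = Abs_fps (\<lambda>i. fps_nth q i div 2)"
  have q: "q = fps_const 2 * q'"
    using even_denominator[OF less.prems] by (intro fps_ext) (simp add: q'_def)
  show ?case
  proof (rule ccontr)
    assume "q \<noteq> 0"
    then obtain k where k: "fps_nth q k \<noteq> 0" by (auto simp: fps_eq_iff)
    then have "k \<le> n" using less.prems(1) by (meson not_le)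
    have lt: "(\<Sum>i\<le>n. nat \<bar>fps_nth q' i\<bar>) < (\<Sum>i\<le>n. nat \<bar>fps_nth q i\<bar>)"
      by (rule sum_strict_mono_ex1) (use k \<open>k \<le> n\<close> in \<open>auto simp: q intro!: bexI[of _ k]\<close>)
    have "q' = 0"
    proof (rule less.hyps[OF lt])
      fix i assume "n < i" then show "fps_nth q' i = 0" using less.prems(1) by (simp add: q'_def)
    next
      fix i assume "n < i" "i < 2 * n + 5"
      then have "fps_nth (q * f) i = 0" by (rule less.prems(2))
      then show "fps_nth (q' * f) i = 0" unfolding q by (simp add: mult.assoc)
    qed
    then show False using \<open>q \<noteq> 0\<close> q by simp
  qed
qed

end

section \<open>The power series of the infinite product\<close>

text \<open>The coefficients of the formal product: \<open>v\<close> multiplied over the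
  base-\<open>p\<close> digits of \<open>n\<close>. The guard \<open>p < 2\<close> ensures
  termination, and the value 1 at 0 fits leading zeros because \<open>v 0 = 1\<close>.\<close>

fun digit_prod :: "nat \<Rightarrow> (nat \<Rightarrow> int) \<Rightarrow> nat \<Rightarrow> int" where
  "digit_prod p v n = (if n = 0 \<or> p < 2 then 1 else v (n mod p) * digit_prod p v (n div p))"

declare digit_prod.simps [simp del]

locale mahler_signs =
  fixes p :: nat and v :: "nat \<Rightarrow> int"
  assumes p3: "p \<ge> 3" and p_odd: "odd p"
    and v0: "v 0 = 1"
    and v_sign: "\<And>i. i < p \<Longrightarrow> v i \<in> {-1, 1}"
    and v_mod: "\<And>m. m \<ge> p \<Longrightarrow> v m = v (m mod p)"
    and v_cong: "\<And>j. j \<le> p - 2 \<Longrightarrow>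
           [(v j + v (j + 1) - v (2 * j + 1) - v (2 * j + 2)) div 2 = 1] (mod 2)"
begin

abbreviation c :: "nat \<Rightarrow> int" where "c \<equiv> digit_prod p v"

lemma c_0 [simp]: "c 0 = 1"
  by (simp add: digit_prod.simps)

lemma c_split:
  assumes "i < p"
  shows "c (p * n + i) = c n * v i"
proof (cases "p * n + i = 0")
  case True
  then show ?thesis using v0 p3 by simp
next
  case False
  then show ?thesis using p3 assms by (subst digit_prod.simps) (auto simp: mult.commute)
qed

lemma v_sign': "v i = -1 \<or> v i = 1"
proof -
  have "i mod p < p" using p3 by simp
  then show ?thesis using v_sign[of i] v_mod[of i] v_sign[of "i mod p"] by (metis insertE not_le singletonD)
qed

lemma c_sign: "c n = -1 \<or> c n = 1"
proof (induction n rule: less_induct)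
  case (less n)
  show ?case
  proof (cases "n = 0")
    case False
    then have "n div p < n" using p3 by simp
    then have "c (n div p) = -1 \<or> c (n div p) = 1" by (rule less)
    moreover have "c n = c (n div p) * v (n mod p)"
      using c_split[of "n mod p" "n div p"] p3 by simp
    ultimately show ?thesis using v_sign'[of "n mod p"] by (metis mult.right_neutral mult_minus_right minus_minus)
  qed simp
qed

lemma v_prod:
  assumes "j \<le> p - 2"
  shows "v j * v (j + 1) * v (2 * j + 1) * v (2 * j + 2) = -1"
proof -
  have "w * x * y * z = -1"
    if "[(w + x - y - z) div 2 = 1] (mod 2)"
      "w = -1 \<or> w = 1" "x = -1 \<or> x = 1" "y = -1 \<or> y = 1" "z = -1 \<or> z = 1" for w x y z :: int
    using that by (elim disjE) (simp_all add: cong_def)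
  from this[OF v_cong[OF assms] v_sign' v_sign' v_sign' v_sign'] show ?thesis .
qed

text \<open>Induction on \<open>n = p * m + j\<close>. For \<open>j = p - 1\<close> the increments
  carry, and the product becomes the one for \<open>m\<close>. Otherwise \<open>n\<close> and
  \<open>n + 1\<close> share their higher digits, and so do \<open>2 * n + 1\<close> and
  \<open>2 * n + 2\<close>; the shared factors square to 1 and \<open>v_prod\<close>
  remains.\<close>

sublocale apwenian c
proof
  show "c n \<in> {-1, 1}" for n using c_sign by auto
  show "c n * c (n + 1) * c (2 * n + 1) * c (2 * n + 2) = -1" for n
  proof (induction n rule: less_induct)
    case (less n)
    define m where "m = n div p"
    define j where "j = n mod p"
    have j: "j < p" and n: "n = p * m + j" using p3 by (auto simp: m_def j_def)
    have sq: "c k * c k = 1" for k using c_sign[of k] by auto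
    have sqv: "v k * v k = 1" for k using v_sign'[of k] by auto
    show ?case
    proof (cases "j = p - 1")
      case True
      have e: "n + 1 = p * (m + 1) + 0" "2 * n + 1 = p * (2 * m + 1) + (p - 1)" "2 * n + 2 = p * (2 * m + 2) + 0"
        using n True p3 by (auto simp: algebra_simps)
      have "m < n" using n True p3 mult_le_mono1[of 1 p m] by linarith
      have "c n * c (n + 1) * c (2 * n + 1) * c (2 * n + 2) =
          (c m * v (p - 1)) * (c (m + 1) * v 0) * (c (2 * m + 1) * v (p - 1)) * (c (2 * m + 2) * v 0)"
        unfolding e unfolding n True using p3 by (simp only: c_split)
      also have "\<dots> = (c m * c (m + 1) * c (2 * m + 1) * c (2 * m + 2)) * (v (p - 1) * v (p - 1))"
        using v0 by simp
      also have "\<dots> = -1" unfolding sqv using less[OF \<open>m < n\<close>] by simp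
      finally show ?thesis .
    next
      case False
      then have j2: "j \<le> p - 2" "j + 1 < p" using j by auto
      have n1: "n + 1 = p * m + (j + 1)" using n by simp
      have "\<exists>k. c (2 * n + 1) = c k * v (2 * j + 1) \<and> c (2 * n + 2) = c k * v (2 * j + 2)"
      proof (cases "2 * j + 2 < p")
        case True
        have "2 * n + 1 = p * (2 * m) + (2 * j + 1)" "2 * n + 2 = p * (2 * m) + (2 * j + 2)"
          using n by (auto simp: algebra_simps)
        moreover have "2 * j + 1 < p" using True by simp
        ultimately show ?thesis using True by (intro exI[of _ "2 * m"]) (simp only: c_split simp_thms)
      next
        case F: False
        \<comment> \<open>Oddness of \<open>p\<close> excludes \<open>2 * j + 2 = p\<close>, the one
          case in which \<open>2 * n + 1\<close> and \<open>2 * n + 2\<close> would differ in their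
          higher digits.\<close>
        have ge: "2 * j + 1 \<ge> p" using F p_odd by (cases "2 * j + 2 = p") auto
        have "2 * n + 1 = p * (2 * m + 1) + (2 * j + 1 - p)" "2 * n + 2 = p * (2 * m + 1) + (2 * j + 2 - p)"
          using n ge by (auto simp: algebra_simps)
        moreover have lt: "2 * j + 1 - p < p" "2 * j + 2 - p < p" using j2(2) by auto
        moreover have "v (2 * j + 1) = v (2 * j + 1 - p)" "v (2 * j + 2) = v (2 * j + 2 - p)"
          using v_mod[of "2 * j + 1"] v_mod[of "2 * j + 2"] ge lt by (auto simp: le_mod_geq)
        ultimately show ?thesis by (intro exI[of _ "2 * m + 1"]) (simp only: c_split simp_thms)
      qed
      then obtain k where k: "c (2 * n + 1) = c k * v (2 * j + 1)" "c (2 * n + 2) = c k * v (2 * j + 2)" by blast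
      have "c n * c (n + 1) * c (2 * n + 1) * c (2 * n + 2) =
          (c m * v j) * (c m * v (j + 1)) * (c k * v (2 * j + 1)) * (c k * v (2 * j + 2))"
        unfolding k n1 unfolding n using c_split[OF j] c_split[OF j2(2)] by simp
      also have "\<dots> = (c m * c m) * (c k * c k) * (v j * v (j + 1) * v (2 * j + 1) * v (2 * j + 2))"
        by (simp only: mult_ac)
      also have "\<dots> = -1" unfolding sq v_prod[OF j2(1)] by simp
      finally show ?thesis .
    qed
  qed
qed

definition P :: "int poly" where "P = (\<Sum>i<p. monom (v i) i)"

lemma coeff_P: "coeff P i = (if i < p then v i else 0)"
proof -
  have "coeff P i = (\<Sum>j<p. if j = i then v j else 0)" by (simp add: P_def coeff_sum)
  then show ?thesis by simp
qed

lemma P_nonzero: "P \<noteq> 0"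
proof
  assume "P = 0"
  then have "coeff P 0 = 0" by simp
  then show False using p3 v0 by (simp add: coeff_P)
qed

lemma f_nth [simp]: "fps_nth f n = c n"
  by (simp add: f_def)

lemma f_functional: "f = fps_of_poly P * (f oo fps_X ^ p)"
proof (rule fps_ext)
  fix n
  have "fps_nth (fps_of_poly P * (f oo fps_X ^ p)) n =
      (\<Sum>i\<in>{0..n}. coeff P i * (if p dvd (n - i) then c ((n - i) div p) else 0))"
    by (simp add: fps_mult_nth fps_nth_compose_X_power cong: if_cong)
  \<comment> \<open>Division with remainder is unique, so a single term of the convolution
    survives.\<close>
  also have "\<dots> = (\<Sum>i\<in>{n mod p}. coeff P i * (if p dvd (n - i) then c ((n - i) div p) else 0))"
  proof (rule sum.mono_neutral_right)
    show "\<forall>i\<in>{0..n} - {n mod p}. coeff P i * (if p dvd (n - i) then c ((n - i) div p) else 0) = 0"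
    proof
      fix i assume i: "i \<in> {0..n} - {n mod p}"
      have False if "i < p" "p dvd n - i"
      proof -
        from that(2) obtain k where "n - i = p * k" by (rule dvdE)
        moreover have "n = n - i + i" using i by simp
        ultimately have "n = p * k + i" by metis
        then show False using i that(1) by auto
      qed
      then show "coeff P i * (if p dvd (n - i) then c ((n - i) div p) else 0) = 0"
        by (auto simp: coeff_P)
    qed
  qed (auto simp: p3)
  also have "\<dots> = v (n mod p) * c (n div p)"
    using p3 by (simp add: coeff_P minus_mod_eq_mult_div)
  also have "\<dots> = c n"
    using c_split[of "n mod p" "n div p"] p3 by simp
  finally show "fps_nth f n = fps_nth (fps_of_poly P * (f oo fps_X ^ p)) n" by simp
qed

end

section \<open>Transcendence of the power series\<close>

text \<open>The hypothesis says that \<open>h / a\<close> is invariant under the substitution. The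
  combination \<open>w\<close> satisfies the same equation as \<open>h\<close>; if it were nonzero,
  comparing subdegrees would give it the subdegree \<open>m\<close> of \<open>a\<close>, but its
  coefficient at \<open>m\<close> is 0 by construction.\<close>

lemma fps_eq_const_mult_if_compose_X_power:
  fixes h a :: "'a :: idom fps"
  assumes "p \<ge> 2" "a \<noteq> 0" and eq: "h * (a oo fps_X ^ p) = (h oo fps_X ^ p) * a"
  shows "fps_const (fps_nth a (subdegree a)) * h = fps_const (fps_nth h (subdegree a)) * a"
proof -
  define m where "m = subdegree a"
  define w where "w = fps_const (fps_nth a m) * h - fps_const (fps_nth h m) * a"
  have X0: "fps_nth (fps_X ^ p :: 'a fps) 0 = 0" using assms(1) by simp
  have wc: "w oo fps_X ^ p = fps_const (fps_nth a m) * (h oo fps_X ^ p) - fps_const (fps_nth h m) * (a oo fps_X ^ p)"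
    by (rule fps_ext) (simp add: w_def fps_nth_compose_X_power)
  have "w * (a oo fps_X ^ p) = fps_const (fps_nth a m) * (h * (a oo fps_X ^ p)) - fps_const (fps_nth h m) * (a * (a oo fps_X ^ p))"
    by (simp add: w_def algebra_simps)
  also have "\<dots> = (w oo fps_X ^ p) * a"
    unfolding wc eq by (simp add: algebra_simps)
  finally have w: "w * (a oo fps_X ^ p) = (w oo fps_X ^ p) * a" .
  have "w = 0"
  proof (rule ccontr)
    assume "w \<noteq> 0"
    have "a oo fps_X ^ p \<noteq> 0" "w oo fps_X ^ p \<noteq> 0"
      using assms \<open>w \<noteq> 0\<close> by (auto simp: fps_compose_eq_0_iff)
    then have "subdegree w + m * p = subdegree w * p + m"
      using arg_cong[OF w, of subdegree] assms \<open>w \<noteq> 0\<close> X0 by (simp add: m_def)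
    then have "int (subdegree w) * (int p - 1) = int m * (int p - 1)"
      by (simp add: algebra_simps flip: of_nat_mult of_nat_add)
    then have "subdegree w = m" using assms(1) by simp
    moreover have "fps_nth w m = 0" by (simp add: w_def mult.commute)
    ultimately show False using \<open>w \<noteq> 0\<close> nth_subdegree_nonzero[of w] by simp
  qed
  then show ?thesis by (simp add: w_def m_def)
qed

lemma order_power:
  fixes q :: "'a :: idom poly"
  assumes "q \<noteq> 0"
  shows "order x (q ^ n) = n * order x q"
  using assms by (induction n) (simp_all add: order_mult)

lemma pcompose_power:
  fixes A B :: "'a :: comm_ring_1 poly"
  shows "pcompose (A ^ n) B = pcompose A B ^ n"
proof (induction n)
  case 0
  show ?case by (metis one_pCons pcompose_const power_0)
qed (simp add: pcompose_mult)

text \<open>Away from 0 the map to the \<open>p\<close>-th power is unramified: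
  \<open>z ^ p - w ^ p\<close> has a simple zero at \<open>w\<close>, so orders are
  preserved.\<close>

lemma order_pcompose_monom:
  fixes A :: "complex poly"
  assumes "A \<noteq> 0" "p > 0" "w \<noteq> 0"
  shows "order w (pcompose A (monom 1 p)) = order (w ^ p) A"
proof -
  obtain A1 where A1: "A = [:- (w ^ p), 1:] ^ order (w ^ p) A * A1" "\<not> [:- (w ^ p), 1:] dvd A1"
    using order_decomp[OF assms(1)] by blast
  define L where "L = pcompose [:- (w ^ p), 1:] (monom 1 p)"
  have L: "L = monom 1 p + [:- (w ^ p):]" by (simp add: L_def pcompose_pCons)
  have "poly (pderiv L) w \<noteq> 0"
    using assms by (simp add: L pderiv_add pderiv_monom pderiv_pCons poly_monom)
  moreover have "L \<noteq> 0" using \<open>poly (pderiv L) w \<noteq> 0\<close> by auto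
  moreover have "poly L w = 0" by (simp add: L poly_monom)
  ultimately have oL: "order w L = 1" using order_pderiv[of L w] order_0I[of "pderiv L" w] by simp
  have nz: "poly (pcompose A1 (monom 1 p)) w \<noteq> 0"
    using A1(2) by (simp add: poly_pcompose poly_monom dvd_iff_poly_eq_0)
  have "pcompose A (monom 1 p) = L ^ order (w ^ p) A * pcompose A1 (monom 1 p)"
    by (subst A1(1)) (simp add: pcompose_mult L_def pcompose_power)
  moreover have "L ^ order (w ^ p) A * pcompose A1 (monom 1 p) \<noteq> 0" using nz \<open>L \<noteq> 0\<close> by auto
  ultimately have "order w (pcompose A (monom 1 p)) = order (w ^ p) A * 1 + order w (pcompose A1 (monom 1 p))"
    using oL \<open>L \<noteq> 0\<close> by (simp add: order_mult order_power)
  then show ?thesis using order_0I[OF nz] by simp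
qed

lemma dvd_order_diff:
  fixes A B P :: "complex poly"
  assumes "p \<ge> 2" and nz: "A \<noteq> 0" "B \<noteq> 0" "P \<noteq> 0"
    and eq: "pcompose B (monom 1 p) * A = B * pcompose A (monom 1 p) * P ^ D"
    and "w \<noteq> 0"
  shows "int D dvd int (order w A) - int (order w B)"
proof (rule ccontr)
  \<comment> \<open>The finite set \<open>S\<close> is closed under \<open>p\<close>-th roots, so it is empty.\<close>
  define S where "S = {w. w \<noteq> 0 \<and> \<not> int D dvd int (order w A) - int (order w B)}"
  assume "\<not> int D dvd int (order w A) - int (order w B)"
  then have "w \<in> S" using \<open>w \<noteq> 0\<close> by (simp add: S_def)
  have nzc: "pcompose A (monom 1 p) \<noteq> 0" "pcompose B (monom 1 p) \<noteq> 0"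
    using nz assms(1) by (auto simp: pcompose_eq_0_iff degree_monom_eq)
  have step: "z \<in> S" if "z ^ p \<in> S" for z
  proof -
    have z: "z \<noteq> 0" using that assms(1) by (auto simp: S_def power_0_left)
    have "order z (pcompose B (monom 1 p) * A) = order (z ^ p) B + order z A"
      using nz nzc z assms(1) by (simp add: order_mult order_pcompose_monom)
    moreover have "order z (B * pcompose A (monom 1 p) * P ^ D) = order z B + order (z ^ p) A + D * order z P"
      using nz nzc z assms(1) by (simp add: order_mult order_pcompose_monom order_power)
    ultimately have "order (z ^ p) B + order z A = order z B + order (z ^ p) A + D * order z P"
      using eq by simp
    then have "int (order z A) - int (order z B) = int (order (z ^ p) A) - int (order (z ^ p) B) + int D * int (order z P)"
      by (simp flip: of_nat_mult of_nat_add)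
    then show ?thesis using that z by (simp add: S_def dvd_add_left_iff)
  qed
  have iter: "z \<in> S" if "z ^ (p ^ k) \<in> S" for z k
    using that
  proof (induction k arbitrary: z)
    case (Suc k)
    then have "(z ^ p) ^ (p ^ k) \<in> S" by (simp add: power_mult)
    then show ?case using Suc.IH step by blast
  qed simp
  have "S \<subseteq> {z. poly A z = 0} \<union> {z. poly B z = 0}"
  proof
    fix z assume "z \<in> S"
    then have "order z A \<noteq> 0 \<or> order z B \<noteq> 0"
      by (cases "order z A = 0"; cases "order z B = 0") (auto simp: S_def)
    then show "z \<in> {z. poly A z = 0} \<union> {z. poly B z = 0}" using order_root[of A z] order_root[of B z] by auto
  qed
  then have fin: "finite S" using nz by (auto intro: finite_subset simp: poly_roots_finite)
  define k where "k = card S"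
  \<comment> \<open>All \<open>p ^ k\<close> roots lie in \<open>S\<close>, and for
    \<open>k = card S\<close> they are more than \<open>S\<close> can hold.\<close>
  have "p ^ k = card {z. z ^ (p ^ k) = w}"
    using \<open>w \<noteq> 0\<close> assms(1) by (subst card_nth_roots) auto
  also have "\<dots> \<le> card S"
    using fin iter \<open>w \<in> S\<close> by (intro card_mono) auto
  finally have "p ^ k \<le> k" by (simp add: k_def)
  moreover have "k < 2 ^ k" by (rule less_exp)
  moreover have "2 ^ k \<le> p ^ k" using assms(1) by (rule power_mono) simp
  ultimately show False by linarith
qed

text \<open>The quotient \<open>u = F / G\<close>, taken among Laurent series to allow division, has
  a constant \<open>D\<close>-th power. Differentiating gives
  \<open>D * u ^ (D - 1) * u' = 0\<close>, so \<open>u\<close> is constant in characteristic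
  0.\<close>

lemma fps_power_eq_const_mult_power:
  fixes F G :: "complex fps"
  assumes "F ^ D = fps_const k * G ^ D" "D > 0" "G \<noteq> 0"
  shows "\<exists>s. F = fps_const s * G"
proof -
  define u where "u = fps_to_fls F / fps_to_fls G"
  have G: "fps_to_fls G \<noteq> 0" using assms(3) by simp
  have "fps_to_fls F ^ D = fls_const k * fps_to_fls G ^ D"
    using arg_cong[OF assms(1), of fps_to_fls] by (simp add: fps_to_fls_power fls_times_fps_to_fls)
  then have uD: "u ^ D = fls_const k" using G by (simp add: u_def power_divide)
  have "u = fls_const (fls_nth u 0)"
  proof (cases "u = 0")
    case False
    have "fls_deriv (u ^ D) = 0" by (simp add: uD)
    then have "fls_deriv u = 0" using False assms(2) by (simp add: fls_deriv_power)
    then show ?thesis by (simp add: fls_deriv_eq_0_iff)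
  qed simp
  then have "fps_to_fls F = fls_const (fls_nth u 0) * fps_to_fls G"
    using G by (metis u_def nonzero_eq_divide_eq)
  also have "\<dots> = fps_to_fls (fps_const (fls_nth u 0) * G)" by (simp add: fls_times_fps_to_fls)
  finally show ?thesis by (auto simp: fps_to_fls_eq_iff)
qed

lemma mahler_root_of_rational:
  fixes A B P :: "complex poly" and F :: "complex fps"
  assumes "p \<ge> 2" "D > 0" and nz: "A \<noteq> 0" "B \<noteq> 0" "P \<noteq> 0" "k \<noteq> 0" "fps_nth F 0 \<noteq> 0"
    and eq: "(fps_of_poly B oo fps_X ^ p) * fps_of_poly A =
       fps_of_poly B * (fps_of_poly A oo fps_X ^ p) * fps_of_poly P ^ D"
    and F: "F ^ D * fps_of_poly B = fps_const k * fps_of_poly A"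
  shows "\<exists>g. F * fps_of_poly B = fps_of_poly g"
proof -
  have comp: "fps_of_poly Q oo fps_X ^ p = fps_of_poly (pcompose Q (monom 1 p))" for Q :: "complex poly"
    using assms(1) by (subst fps_of_poly_pcompose) (auto simp: fps_of_poly_monom')
  have "fps_of_poly (pcompose B (monom 1 p) * A) = fps_of_poly (B * pcompose A (monom 1 p) * P ^ D)"
    using eq by (simp add: comp fps_of_poly_mult fps_of_poly_power)
  then have eq': "pcompose B (monom 1 p) * A = B * pcompose A (monom 1 p) * P ^ D"
    by (simp only: fps_of_poly_eq_iff)
  \<comment> \<open>Since \<open>F\<close> does not vanish at 0, the orders of \<open>A\<close> and
    \<open>B\<close> at 0 agree. This settles the point that \<open>dvd_order_diff\<close> leaves
    out.\<close>
  have "subdegree (F ^ D * fps_of_poly B) = subdegree (fps_const k * fps_of_poly A)" using F by simp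
  moreover have "F ^ D \<noteq> 0" "F \<noteq> 0" using nz(5) by auto
  ultimately have o0: "order 0 B = order 0 A"
    using nz by (simp add: subdegree_fps_of_poly subdegree_eq_0)
  have dvd: "int D dvd int (order w A) - int (order w B)" for w
    using dvd_order_diff[OF assms(1) nz(1-3) eq'] o0 by (cases "w = 0") auto
  \<comment> \<open>All orders of \<open>W\<close> are multiples of \<open>D\<close>, so \<open>W\<close> is a constant times a \<open>D\<close>-th power, and
    \<open>(F B)\<^sup>D = k W\<close>.\<close>
  define W where "W = B ^ (D - 1) * A"
  have dvdW: "D dvd order w W" for w
  proof -
    have "order w W = (D - 1) * order w B + order w A"
      using nz by (simp add: W_def order_mult order_power)
    then have "int (order w W) = int D * int (order w B) + (int (order w A) - int (order w B))"
      using assms(2) by (cases D) (simp_all add: algebra_simps)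
    then have "int D dvd int (order w W)" using dvd[of w] by simp
    then show ?thesis by simp
  qed
  define g where "g = (\<Prod>z | poly W z = 0. [:- z, 1:] ^ (order z W div D))"
  have "g ^ D = (\<Prod>z | poly W z = 0. [:- z, 1:] ^ order z W)"
    unfolding g_def prod_power_distrib by (simp add: dvdW flip: power_mult)
  then have W: "W = smult (lead_coeff W) (g ^ D)" using complex_poly_decompose[of W] by simp
  have "W \<noteq> 0" using nz by (simp add: W_def)
  then have "g \<noteq> 0" using W assms(2) by (metis power_eq_0_iff smult_0_right)
  have BD: "fps_of_poly B ^ D = fps_of_poly B * fps_of_poly B ^ (D - 1)"
    using assms(2) by (simp flip: power_Suc)
  have "(F * fps_of_poly B) ^ D = (F ^ D * fps_of_poly B) * fps_of_poly B ^ (D - 1)"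
    by (simp add: power_mult_distrib BD mult.assoc)
  also have "\<dots> = fps_const k * fps_of_poly W"
    unfolding F by (simp add: W_def fps_of_poly_mult fps_of_poly_power mult_ac)
  also have "\<dots> = fps_const (k * lead_coeff W) * fps_of_poly g ^ D"
    by (subst W) (simp add: fps_of_poly_smult fps_of_poly_power mult.assoc flip: fps_const_mult)
  finally obtain s where "F * fps_of_poly B = fps_const s * fps_of_poly g"
    using fps_power_eq_const_mult_power assms(2) \<open>g \<noteq> 0\<close>
    by (metis fps_of_poly_0 fps_of_poly_eq_iff)
  then have "F * fps_of_poly B = fps_of_poly (smult s g)" by (simp add: fps_of_poly_smult)
  then show ?thesis by blast
qed

lemma fps_of_int_fps_compose_X_power:
  "fps_of_int_fps (F oo fps_X ^ n) = fps_of_int_fps F oo (fps_X ^ n :: 'a :: idom fps)"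
  by (rule fps_ext) (simp add: fps_nth_compose_X_power)

lemma fps_compose_sum_distrib':
  fixes g :: "'a :: idom fps"
  assumes "fps_nth g 0 = 0"
  shows "(\<Sum>j\<le>(n::nat). F j * G ^ j) oo g = (\<Sum>j\<le>n. (F j oo g) * (G oo g) ^ j)"
  using assms by (simp add: fps_compose_sum_distrib fps_compose_mult_distrib fps_compose_power)

section \<open>Algebraic independence of the series from \<open>z\<close>\<close>

context mahler_signs
begin

text \<open>Beyond the degrees of \<open>B\<close> and \<open>g\<close> all coefficients of the
  product vanish, against \<open>badly_approximable\<close>. The numerator may be complex, as only
  the position of its zero coefficients matters.\<close>

lemma f_not_rational:
  fixes B :: "int poly" and g :: "complex poly"
  assumes "fps_of_int_fps f * fps_of_poly (map_poly of_int B) = fps_of_poly g"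
  shows "B = 0"
proof -
  define n where "n = max (degree B) (degree g)"
  have "fps_of_poly B = 0"
  proof (rule badly_approximable)
    fix i assume "n < i" then show "fps_nth (fps_of_poly B) i = 0" by (simp add: n_def coeff_eq_0)
  next
    fix i assume "n < i"
    have "fps_nth (fps_of_int_fps (f * fps_of_poly B)) i = coeff g i"
      using assms by (simp add: fps_of_int_fps_mult fps_of_int_fps_of_poly)
    also have "\<dots> = 0" using \<open>n < i\<close> by (simp add: n_def coeff_eq_0)
    finally show "fps_nth (fps_of_poly B * f) i = 0" by (simp add: mult.commute)
  qed
  then show ?thesis by (simp flip: fps_of_poly_0 add: fps_of_poly_eq_iff)
qed

lemma f_transcendental:
  fixes r :: "nat \<Rightarrow> int poly"
  assumes "(\<Sum>j\<le>N. fps_of_poly (r j) * f ^ j) = 0" "j \<le> N"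
  shows "r j = 0"
proof (rule ccontr)
  assume "r j \<noteq> 0"
  define Rel where "Rel = (\<lambda>N. \<exists>r. (\<exists>j\<le>N. r j \<noteq> (0 :: int poly)) \<and> (\<Sum>j\<le>N. fps_of_poly (r j) * f ^ j) = 0)"
  define D where "D = (LEAST N. Rel N)"
  have "Rel N" using assms \<open>r j \<noteq> 0\<close> unfolding Rel_def by blast
  then have "Rel D" unfolding D_def by (rule LeastI)
  \<comment> \<open>Minimality of \<open>D\<close> as linear independence of the powers of
    \<open>f\<close> below \<open>D\<close> over the polynomials.\<close>
  have min: "s j = 0" if "(\<Sum>j<D. fps_of_poly (s j) * f ^ j) = 0" "j < D" for s :: "nat \<Rightarrow> int poly" and j
  proof -
    from \<open>j < D\<close> obtain d where d: "D = Suc d" by (cases D) auto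
    have "\<not> Rel d" using not_less_Least[of d Rel] d unfolding D_def by simp
    then show ?thesis using that unfolding Rel_def d lessThan_Suc_atMost by (auto simp: less_Suc_eq_le)
  qed
  from \<open>Rel D\<close> obtain r where r: "\<exists>j\<le>D. r j \<noteq> 0" "(\<Sum>j\<le>D. fps_of_poly (r j) * f ^ j) = 0"
    unfolding Rel_def by blast
  have f0: "f \<noteq> 0"
  proof
    assume "f = 0" then have "fps_nth f 0 = 0" by simp
    then show False by simp
  qed
  have sumD: "(\<Sum>j\<le>D. F j) = (\<Sum>j<D. F j) + F D" for F :: "nat \<Rightarrow> int fps"
    by (metis lessThan_Suc_atMost sum.lessThan_Suc)
  have rD: "r D \<noteq> 0"
  proof
    assume "r D = 0"
    then have "(\<Sum>j<D. fps_of_poly (r j) * f ^ j) = 0" using r(2) by (simp add: sumD)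
    then show False using min[of r] r(1) \<open>r D = 0\<close> by (metis le_neq_implies_less)
  qed
  have "D > 0"
  proof (rule ccontr)
    assume "\<not> D > 0"
    then show False using r(2) rD by (simp flip: fps_of_poly_0 add: fps_of_poly_eq_iff)
  qed
  \<comment> \<open>Otherwise dividing the relation by \<open>f\<close> would lower its
    degree.\<close>
  have r0: "r 0 \<noteq> 0"
  proof
    assume "r 0 = 0"
    have "(\<Sum>j\<le>D. fps_of_poly (r j) * f ^ j) = (\<Sum>j<Suc D. fps_of_poly (r j) * f ^ j)"
      by (simp add: lessThan_Suc_atMost)
    also have "\<dots> = f * (\<Sum>j<D. fps_of_poly (r (Suc j)) * f ^ j)"
      by (subst sum.lessThan_Suc_shift) (simp add: \<open>r 0 = 0\<close> sum_distrib_left mult_ac)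
    finally have "(\<Sum>j<D. fps_of_poly (r (Suc j)) * f ^ j) = 0" using r(2) f0 by simp
    then have "r (Suc (D - 1)) = 0" using \<open>D > 0\<close> by (intro min[of "\<lambda>j. r (Suc j)"]) auto
    then show False using rD \<open>D > 0\<close> by simp
  qed
  define A where "A = r 0"
  define B where "B = r D"
  define sg where "sg = (\<lambda>Q :: int poly. pcompose Q (monom 1 p))"
  define fs where "fs = f oo fps_X ^ p"
  have X0: "fps_nth (fps_X ^ p :: int fps) 0 = 0" using p3 by simp
  have sg: "fps_of_poly (sg Q) = fps_of_poly Q oo fps_X ^ p" for Q
    using p3 by (simp add: sg_def fps_of_poly_pcompose fps_of_poly_monom')
  have ffs: "f = fps_of_poly P * fs" unfolding fs_def by (rule f_functional)
  define r' where "r' = (\<lambda>j. sg (r j) * P ^ (D - j))"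
  have "(\<Sum>j\<le>D. fps_of_poly (sg (r j)) * fs ^ j) = 0"
    using arg_cong[OF r(2), of "\<lambda>x. x oo fps_X ^ p"] X0
    by (simp add: fps_compose_sum_distrib' sg fs_def)
  then have "(\<Sum>j\<le>D. fps_of_poly P ^ D * (fps_of_poly (sg (r j)) * fs ^ j)) = 0"
    by (simp flip: sum_distrib_left)
  also have "(\<Sum>j\<le>D. fps_of_poly P ^ D * (fps_of_poly (sg (r j)) * fs ^ j)) = (\<Sum>j\<le>D. fps_of_poly (r' j) * f ^ j)"
  proof (rule sum.cong)
    fix j assume "j \<in> {..D}"
    then have "fps_of_poly P ^ D = fps_of_poly P ^ (D - j) * fps_of_poly P ^ j" by (simp flip: power_add)
    then show "fps_of_poly P ^ D * (fps_of_poly (sg (r j)) * fs ^ j) = fps_of_poly (r' j) * f ^ j"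
      by (subst ffs) (simp add: r'_def fps_of_poly_mult fps_of_poly_power power_mult_distrib mult_ac)
  qed simp
  finally have r': "(\<Sum>j\<le>D. fps_of_poly (r' j) * f ^ j) = 0" .
  \<comment> \<open>Substituting \<open>z\<^sup>p\<close> for \<open>z\<close> in the relation and cancelling the leading term leaves a relation of smaller degree.\<close>
  define s where "s = (\<lambda>j. sg B * r j - B * r' j)"
  have "(\<Sum>j\<le>D. fps_of_poly (s j) * f ^ j) =
      fps_of_poly (sg B) * (\<Sum>j\<le>D. fps_of_poly (r j) * f ^ j) - fps_of_poly B * (\<Sum>j\<le>D. fps_of_poly (r' j) * f ^ j)"
    by (simp add: s_def fps_of_poly_diff fps_of_poly_mult sum_subtractf sum_distrib_left algebra_simps)
  then have "(\<Sum>j\<le>D. fps_of_poly (s j) * f ^ j) = 0" using r r' by simp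
  moreover have "s D = 0" by (simp add: s_def r'_def B_def)
  ultimately have "(\<Sum>j<D. fps_of_poly (s j) * f ^ j) = 0" by (simp add: sumD)
  then have "s 0 = 0" using \<open>D > 0\<close> by (rule min)
  then have AB: "sg B * A = B * sg A * P ^ D" by (simp add: s_def r'_def A_def mult_ac)
  then have AB': "fps_of_poly (sg B) * fps_of_poly A = fps_of_poly B * fps_of_poly (sg A) * fps_of_poly P ^ D"
    by (simp flip: fps_of_poly_mult fps_of_poly_power)
  \<comment> \<open>By \<open>AB'\<close>, \<open>h\<close> satisfies the same functional equation
    as \<open>A\<close>, hence is a constant multiple of \<open>A\<close>. This is the rationality
    of \<open>f ^ D\<close>.\<close>
  define h where "h = f ^ D * fps_of_poly B"
  have "h * (fps_of_poly A oo fps_X ^ p) = fs ^ D * (fps_of_poly B * fps_of_poly (sg A) * fps_of_poly P ^ D)"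
    unfolding h_def sg[symmetric] by (subst ffs) (simp add: power_mult_distrib mult_ac)
  also have "\<dots> = fs ^ D * (fps_of_poly (sg B) * fps_of_poly A)" by (simp only: AB')
  also have "\<dots> = (h oo fps_X ^ p) * fps_of_poly A"
    unfolding h_def sg fs_def using X0 by (simp add: fps_compose_mult_distrib fps_compose_power mult_ac)
  finally have hA: "h * (fps_of_poly A oo fps_X ^ p) = (h oo fps_X ^ p) * fps_of_poly A" .
  define m where "m = subdegree (fps_of_poly A)"
  have A0: "fps_of_poly A \<noteq> 0" using r0 by (simp add: A_def flip: fps_of_poly_0 add: fps_of_poly_eq_iff)
  have B0: "fps_of_poly B \<noteq> 0" using rD by (simp add: B_def flip: fps_of_poly_0 add: fps_of_poly_eq_iff)
  have hA': "fps_const (fps_nth (fps_of_poly A) m) * h = fps_const (fps_nth h m) * fps_of_poly A"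
    unfolding m_def by (rule fps_eq_const_mult_if_compose_X_power[OF _ A0 hA]) (use p3 in simp)
  have k1: "fps_nth (fps_of_poly A) m \<noteq> 0" unfolding m_def using A0 by (rule nth_subdegree_nonzero)
  have "h \<noteq> 0" using f0 B0 by (simp add: h_def)
  have k2: "fps_nth h m \<noteq> 0"
  proof
    assume "fps_nth h m = 0"
    then show False using hA' k1 \<open>h \<noteq> 0\<close> by (simp add: fps_const_eq_0_iff)
  qed
  define k :: complex where "k = of_int (fps_nth h m) / of_int (fps_nth (fps_of_poly A) m)"
  define cA cB cP :: "complex poly"
    where "cA = map_poly of_int A" and "cB = map_poly of_int B" and "cP = map_poly of_int P"
  note cA_cB_cP_def = this
  define F :: "complex fps" where "F = fps_of_int_fps f"
  have "\<exists>g. F * fps_of_poly cB = fps_of_poly g"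
  proof (rule mahler_root_of_rational[where p = p and D = D and A = cA and P = cP and k = k])
    show "p \<ge> 2" "D > 0" "k \<noteq> 0" "fps_nth F 0 \<noteq> 0" using p3 \<open>D > 0\<close> k1 k2 by (auto simp: k_def F_def)
    show "cA \<noteq> 0" "cB \<noteq> 0" "cP \<noteq> 0" using r0 rD P_nonzero
      by (auto simp: cA_cB_cP_def A_def B_def map_poly_eq_0_iff)
    show "(fps_of_poly cB oo fps_X ^ p) * fps_of_poly cA =
       fps_of_poly cB * (fps_of_poly cA oo fps_X ^ p) * fps_of_poly cP ^ D"
      using arg_cong[OF AB', of "fps_of_int_fps :: int fps \<Rightarrow> complex fps"] unfolding sg
      by (simp add: fps_of_int_fps_mult fps_of_int_fps_compose_X_power fps_of_int_fps_of_poly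
          fps_of_int_fps_power cA_cB_cP_def)
    show "F ^ D * fps_of_poly cB = fps_const k * fps_of_poly cA"
    proof (rule fps_ext)
      fix n
      have "fps_nth (fps_of_poly A) m * fps_nth h n = fps_nth h m * coeff A n"
        using arg_cong[OF hA', of "\<lambda>x. fps_nth x n"] by simp
      then have "(of_int (fps_nth (fps_of_poly A) m) :: complex) * of_int (fps_nth h n) = of_int (fps_nth h m) * of_int (coeff A n)"
        by (simp flip: of_int_mult)
      then have "of_int (fps_nth h n) = k * of_int (coeff A n)"
        using k1 by (simp add: k_def field_simps)
      moreover have "F ^ D * fps_of_poly cB = fps_of_int_fps h"
        by (simp add: F_def h_def cA_cB_cP_def fps_of_int_fps_mult fps_of_int_fps_power fps_of_int_fps_of_poly)
      ultimately show "fps_nth (F ^ D * fps_of_poly cB) n = fps_nth (fps_const k * fps_of_poly cA) n"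
        by (simp add: cA_cB_cP_def coeff_map_poly)
    qed
  qed
  then have "B = 0" using f_not_rational unfolding F_def cA_cB_cP_def by blast
  then show False using rD by (simp add: B_def)
qed

end

section \<open>Transcendence of the value\<close>

text \<open>The order of the quantifiers is essential: the exponent \<open>\<kappa>\<close> depends
  on \<open>\<xi>\<close> alone, so that \<open>N\<close> can later be chosen large in terms of it;
  only the constant \<open>C\<close> depends on \<open>N\<close>.\<close>

lemma algebraic_lower_bound:
  fixes \<xi> :: real
  assumes "algebraic \<xi>"
  shows "\<exists>\<kappa>. \<forall>N. \<exists>C>0. \<forall>(t :: nat \<Rightarrow> int) (H :: int). H \<ge> 1 \<longrightarrow> (\<forall>k\<le>N. \<bar>t k\<bar> \<le> H) \<longrightarrow>
    (\<Sum>k\<le>N. t k * \<xi> ^ k) \<noteq> 0 \<longrightarrow> 1 \<le> C * real_of_int H ^ \<kappa> * \<bar>\<Sum>k\<le>N. t k * \<xi> ^ k\<bar>"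
proof -
  define Rel where "Rel = (\<lambda>d. \<exists>a :: nat \<Rightarrow> int. (\<exists>i\<le>d. a i \<noteq> (0 :: int)) \<and> (\<Sum>i\<le>d. a i * \<xi> ^ i) = 0)"
  define d where "d = (LEAST d. Rel d)"
  obtain A where A: "A \<noteq> 0" "poly (map_poly of_int A) \<xi> = 0" using algebraicE'[OF assms] by metis
  have "coeff A (degree A) \<noteq> 0" using A(1) by simp
  moreover have "(\<Sum>i\<le>degree A. real_of_int (coeff A i) * \<xi> ^ i) = 0"
    using A(2) by (simp add: poly_altdef coeff_map_poly degree_map_poly)
  ultimately have "Rel (degree A)" unfolding Rel_def by blast
  then have "Rel d" unfolding d_def by (rule LeastI)
  then obtain a where a: "\<exists>i\<le>d. a i \<noteq> (0 :: int)" "(\<Sum>i\<le>d. a i * \<xi> ^ i) = 0" unfolding Rel_def by blast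
  have indep: "y j = 0" if "(\<Sum>i<d. y i * \<xi> ^ i) = 0" "j < d" for y :: "nat \<Rightarrow> int" and j
  proof -
    from \<open>j < d\<close> obtain e where e: "d = Suc e" by (cases d) auto
    have "\<not> Rel e" using not_less_Least[of e Rel] e unfolding d_def by simp
    then show ?thesis using that unfolding Rel_def e lessThan_Suc_atMost by (auto simp: less_Suc_eq_le)
  qed
  have a': "(\<Sum>i<d. a i * \<xi> ^ i) + a d * \<xi> ^ d = 0"
    using a(2) by (metis (no_types, lifting) lessThan_Suc_atMost sum.lessThan_Suc)
  have ad: "a d \<noteq> 0"
  proof
    assume "a d = 0"
    then show False using a' indep[of a] a(1) by (auto simp: le_less)
  qed
  have "d > 0"
    using a' ad by (cases d) auto
  then obtain e where e: "d = Suc e" by (cases d) auto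
  \<comment> \<open>Reducing \<open>\<xi> ^ i\<close> to degree below \<open>d\<close> by the
    minimal relation divides by its leading coefficient at most \<open>i\<close> times; the factor
    \<open>a d ^ i\<close> clears these denominators.\<close>
  have "\<exists>\<rho>. real_of_int (a d) ^ i * \<xi> ^ i = (\<Sum>j<d. real_of_int (\<rho> j) * \<xi> ^ j)" for i
  proof (induction i)
    case 0
    show ?case by (intro exI[of _ "\<lambda>j. if j = 0 then 1 else 0"]) (simp add: e sum.lessThan_Suc_shift del: sum.lessThan_Suc)
  next
    case (Suc i)
    then obtain \<rho> where \<rho>: "real_of_int (a d) ^ i * \<xi> ^ i = (\<Sum>j<d. real_of_int (\<rho> j) * \<xi> ^ j)" by blast
    define \<rho>' where "\<rho>' = (\<lambda>j. (if j = 0 then 0 else a d * \<rho> (j - 1)) - \<rho> e * a j)"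
    have "real_of_int (a d) ^ Suc i * \<xi> ^ Suc i = a d * \<xi> * (\<Sum>j<d. real_of_int (\<rho> j) * \<xi> ^ j)"
      by (simp flip: \<rho>)
    also have "\<dots> = (\<Sum>j<e. real_of_int (a d * \<rho> j) * \<xi> ^ Suc j) + \<rho> e * (a d * \<xi> ^ d)"
      by (simp add: e sum_distrib_left algebra_simps)
    also have "a d * \<xi> ^ d = - (\<Sum>i<d. a i * \<xi> ^ i)" using a' by simp
    also have "(\<Sum>j<e. real_of_int (a d * \<rho> j) * \<xi> ^ Suc j) = (\<Sum>j<d. real_of_int (if j = 0 then 0 else a d * \<rho> (j - 1)) * \<xi> ^ j)"
      unfolding e by (subst sum.lessThan_Suc_shift) (simp del: sum.lessThan_Suc)
    also have "\<dots> + \<rho> e * - (\<Sum>i<d. a i * \<xi> ^ i) = (\<Sum>j<d. real_of_int (\<rho>' j) * \<xi> ^ j)"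
      by (simp add: \<rho>'_def sum_subtractf sum_distrib_left algebra_simps)
    finally show ?case by blast
  qed
  then obtain \<rho> where \<rho>: "\<And>i. real_of_int (a d) ^ i * \<xi> ^ i = (\<Sum>j<d. real_of_int (\<rho> i j) * \<xi> ^ j)" by metis
  \<comment> \<open>The exponent of \<open>homogeneous_system\<close> for the \<open>d - 1\<close>
    equations that annihilate the columns \<open>1\<close> to \<open>d - 1\<close>.\<close>
  define \<kappa> where "\<kappa> = (3 ^ (d - 1) :: nat)"
  show ?thesis
  proof (intro exI[of _ \<kappa>] allI)
    fix N :: nat
    \<comment> \<open>For \<open>i < d\<close> and \<open>k\<close> at most \<open>N\<close> the
      natural subtraction in the exponent does not truncate, so one common power of
      \<open>a d\<close> serves all products.\<close>
    define q where "q = (\<lambda>i j k. a d ^ (N + d - (i + k)) * \<rho> (i + k) j)"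
    define K where "K = 1 + (\<Sum>i<d. \<Sum>j<d. \<Sum>k\<le>N. \<bar>q i j k\<bar>)"
    have K1: "K \<ge> 1" unfolding K_def by (simp add: sum_nonneg)
    have K: "(\<Sum>k\<le>N. \<bar>q i j k\<bar>) \<le> K" if "i < d" "j < d" for i j
    proof -
      have "(\<Sum>k\<le>N. \<bar>q i j k\<bar>) \<le> (\<Sum>j<d. \<Sum>k\<le>N. \<bar>q i j k\<bar>)"
        using that by (intro member_le_sum) (auto intro: sum_nonneg)
      also have "\<dots> \<le> (\<Sum>i<d. \<Sum>j<d. \<Sum>k\<le>N. \<bar>q i j k\<bar>)"
        using that by (intro member_le_sum[of i "{..<d}" "\<lambda>i. \<Sum>j<d. \<Sum>k\<le>N. \<bar>q i j k\<bar>"]) (auto intro!: sum_nonneg)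
      finally show ?thesis by (simp add: K_def)
    qed
    define C where "C = 1 + \<bar>real_of_int (a d)\<bar> ^ (N + d) * (\<Sum>i<d. real_of_int (2 * int d * K) ^ \<kappa> * \<bar>\<xi>\<bar> ^ i)"
    have "C > 0" unfolding C_def using K1 by (intro add_pos_nonneg mult_nonneg_nonneg sum_nonneg) auto
    moreover have "1 \<le> C * real_of_int H ^ \<kappa> * \<bar>\<Sum>k\<le>N. t k * \<xi> ^ k\<bar>"
      if H: "H \<ge> 1" and t: "\<forall>k\<le>N. \<bar>t k\<bar> \<le> H" and nz: "(\<Sum>k\<le>N. t k * \<xi> ^ k) \<noteq> 0" for t :: "nat \<Rightarrow> int" and H :: int
    proof -
      \<comment> \<open>\<open>M\<close> represents multiplication by \<open>T\<close>. An integer combination of its rows that is supported on the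
        first column exhibits a multiple of \<open>T\<close> that is a nonzero integer.\<close>
      define T where "T = (\<Sum>k\<le>N. t k * \<xi> ^ k)"
      define M where "M = (\<lambda>j i. \<Sum>k\<le>N. t k * q i j k)"
      have M: "real_of_int (a d) ^ (N + d) * \<xi> ^ i * T = (\<Sum>j<d. real_of_int (M j i) * \<xi> ^ j)" if "i < d" for i
      proof -
        have "real_of_int (a d) ^ (N + d) * \<xi> ^ i * T
            = (\<Sum>k\<le>N. t k * (real_of_int (a d) ^ (N + d - (i + k)) * (real_of_int (a d) ^ (i + k) * \<xi> ^ (i + k))))"
          unfolding T_def sum_distrib_left
        proof (rule sum.cong)
          fix k assume "k \<in> {..N}"
          then have "N + d = (N + d - (i + k)) + (i + k)" using that by simp
          then have "real_of_int (a d) ^ (N + d) = real_of_int (a d) ^ (N + d - (i + k)) * real_of_int (a d) ^ (i + k)"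
            by (metis power_add)
          then show "real_of_int (a d) ^ (N + d) * \<xi> ^ i * (t k * \<xi> ^ k) =
             t k * (real_of_int (a d) ^ (N + d - (i + k)) * (real_of_int (a d) ^ (i + k) * \<xi> ^ (i + k)))"
            by (simp add: power_add mult_ac)
        qed simp
        also have "\<dots> = (\<Sum>k\<le>N. \<Sum>j<d. real_of_int (t k * q i j k) * \<xi> ^ j)"
          unfolding \<rho> by (simp add: q_def sum_distrib_left mult_ac)
        also have "\<dots> = (\<Sum>j<d. real_of_int (M j i) * \<xi> ^ j)"
          by (subst sum.swap) (simp add: M_def sum_distrib_right)
        finally show ?thesis .
      qed
      have Mb: "\<bar>M j i\<bar> \<le> K * H" if "i < d" "j < d" for i j
      proof -
        have "\<bar>M j i\<bar> \<le> (\<Sum>k\<le>N. \<bar>t k * q i j k\<bar>)" unfolding M_def by (rule sum_abs)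
        also have "\<dots> \<le> (\<Sum>k\<le>N. H * \<bar>q i j k\<bar>)"
          unfolding abs_mult using t by (intro sum_mono mult_right_mono) auto
        also have "\<dots> = (\<Sum>k\<le>N. \<bar>q i j k\<bar>) * H" by (simp add: sum_distrib_left mult.commute)
        also have "\<dots> \<le> K * H" using K[OF that] H by (intro mult_right_mono) auto
        finally show ?thesis .
      qed
      have "\<exists>y. (\<exists>i\<in>{..<d}. y i \<noteq> 0) \<and> (\<forall>i\<in>{..<d}. \<bar>y i\<bar> \<le> (2 * int d * (K * H)) ^ 3 ^ card {1..<d}) \<and>
          (\<forall>j\<in>{1..<d}. (\<Sum>i\<in>{..<d}. M j i * y i) = 0)"
        using \<open>d > 0\<close> Mb mult_mono[of 1 K 1 H] K1 H by (intro homogeneous_system) auto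
      then obtain y where y': "\<exists>i\<in>{..<d}. y i \<noteq> 0"
          "\<forall>i\<in>{..<d}. \<bar>y i\<bar> \<le> (2 * int d * (K * H)) ^ 3 ^ card {1..<d}"
          "\<forall>j\<in>{1..<d}. (\<Sum>i\<in>{..<d}. M j i * y i) = 0" by blast
      have y: "\<exists>i<d. y i \<noteq> 0" "\<And>i. i < d \<Longrightarrow> \<bar>y i\<bar> \<le> (2 * int d * (K * H)) ^ \<kappa>"
          "\<And>j. 0 < j \<Longrightarrow> j < d \<Longrightarrow> (\<Sum>i<d. M j i * y i) = 0"
        using y' unfolding \<kappa>_def by auto
      define Y where "Y = (\<Sum>i<d. y i * \<xi> ^ i)"
      have "Y \<noteq> 0" using indep[of y] y(1) unfolding Y_def by blast
      define m where "m = (\<Sum>i<d. M 0 i * y i)"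
      have "real_of_int (a d) ^ (N + d) * T * Y = (\<Sum>i<d. y i * (real_of_int (a d) ^ (N + d) * \<xi> ^ i * T))"
        by (simp add: Y_def sum_distrib_left mult_ac)
      also have "\<dots> = (\<Sum>i<d. \<Sum>j<d. real_of_int (M j i * y i) * \<xi> ^ j)"
      proof (intro sum.cong refl)
        fix i assume "i \<in> {..<d}"
        then show "y i * (real_of_int (a d) ^ (N + d) * \<xi> ^ i * T) = (\<Sum>j<d. real_of_int (M j i * y i) * \<xi> ^ j)"
          using M[of i] by (simp only: lessThan_iff) (simp add: sum_distrib_left mult_ac)
      qed
      also have "\<dots> = (\<Sum>j<d. real_of_int (\<Sum>i<d. M j i * y i) * \<xi> ^ j)"
        by (subst sum.swap) (simp add: sum_distrib_right)
      also have "\<dots> = (\<Sum>j\<in>{0}. real_of_int (\<Sum>i<d. M j i * y i) * \<xi> ^ j)"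
        using \<open>d > 0\<close> y(3) by (intro sum.mono_neutral_right) auto
      finally have m: "real_of_int (a d) ^ (N + d) * T * Y = m" by (simp add: m_def)
      have "m \<noteq> 0"
      proof
        assume "m = 0"
        then show False using m ad nz \<open>Y \<noteq> 0\<close> by (simp add: T_def)
      qed
      have "\<bar>Y\<bar> \<le> (\<Sum>i<d. \<bar>y i * \<xi> ^ i\<bar>)" unfolding Y_def by (rule sum_abs)
      also have "\<dots> \<le> (\<Sum>i<d. real_of_int ((2 * int d * (K * H)) ^ \<kappa>) * \<bar>\<xi>\<bar> ^ i)"
        unfolding abs_mult power_abs
      proof (intro sum_mono mult_right_mono)
        fix i assume "i \<in> {..<d}"
        then show "\<bar>real_of_int (y i)\<bar> \<le> real_of_int ((2 * int d * (K * H)) ^ \<kappa>)"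
          using y(2)[of i] by (metis lessThan_iff of_int_abs of_int_le_iff)
      qed simp
      also have "\<dots> = real_of_int H ^ \<kappa> * (\<Sum>i<d. real_of_int (2 * int d * K) ^ \<kappa> * \<bar>\<xi>\<bar> ^ i)"
        by (simp add: sum_distrib_left power_mult_distrib mult_ac)
      finally have Yb: "\<bar>Y\<bar> \<le> real_of_int H ^ \<kappa> * (\<Sum>i<d. real_of_int (2 * int d * K) ^ \<kappa> * \<bar>\<xi>\<bar> ^ i)" .
      have "1 \<le> \<bar>real_of_int m\<bar>" using \<open>m \<noteq> 0\<close> by linarith
      also have "\<dots> = \<bar>real_of_int (a d)\<bar> ^ (N + d) * \<bar>T\<bar> * \<bar>Y\<bar>"
        unfolding m[symmetric] by (simp add: abs_mult power_abs)
      also have "\<dots> \<le> \<bar>real_of_int (a d)\<bar> ^ (N + d) * \<bar>T\<bar> *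
          (real_of_int H ^ \<kappa> * (\<Sum>i<d. real_of_int (2 * int d * K) ^ \<kappa> * \<bar>\<xi>\<bar> ^ i))"
        using Yb by (intro mult_left_mono) auto
      also have "\<dots> = (C - 1) * real_of_int H ^ \<kappa> * \<bar>T\<bar>"
        unfolding C_def by (simp add: mult_ac)
      also have "\<dots> \<le> C * real_of_int H ^ \<kappa> * \<bar>T\<bar>" using H by (intro mult_right_mono) auto
      finally show ?thesis by (simp add: T_def)
    qed
    ultimately show "\<exists>C>0. \<forall>(t :: nat \<Rightarrow> int) (H :: int). H \<ge> 1 \<longrightarrow> (\<forall>k\<le>N. \<bar>t k\<bar> \<le> H) \<longrightarrow>
      (\<Sum>k\<le>N. t k * \<xi> ^ k) \<noteq> 0 \<longrightarrow> 1 \<le> C * real_of_int H ^ \<kappa> * \<bar>\<Sum>k\<le>N. t k * \<xi> ^ k\<bar>"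
      by blast
  qed
qed

text \<open>After division by \<open>x ^ subdegree E\<close> the series is continuous at 0, with the
  nonzero leading coefficient of \<open>E\<close> as its value there.\<close>

lemma eval_fps_subdegree_bounds:
  fixes E :: "real fps"
  assumes "fps_conv_radius E > 0" "E \<noteq> 0"
  shows "\<exists>\<delta>>0. \<exists>c1>0. \<exists>c2>0. \<forall>x. 0 < x \<longrightarrow> x < \<delta> \<longrightarrow>
    c1 * x ^ subdegree E \<le> \<bar>eval_fps E x\<bar> \<and> \<bar>eval_fps E x\<bar> \<le> c2 * x ^ subdegree E"
proof -
  define M where "M = subdegree E"
  define G where "G = fps_shift M E"
  define g where "g = \<bar>fps_nth E M\<bar>"
  have g: "g > 0" using assms(2) by (simp add: g_def M_def)
  have R: "fps_conv_radius G > 0" using assms(1) by (simp add: G_def)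
  have "continuous (at 0 within UNIV) (eval_fps G)" using R by (intro continuous_eval_fps) (simp add: zero_ereal_def)
  then have "(eval_fps G \<longlongrightarrow> eval_fps G 0) (at 0)" by (simp add: isCont_def)
  then have "((\<lambda>x. \<bar>eval_fps G x\<bar>) \<longlongrightarrow> g) (at 0)"
    by (auto dest!: tendsto_rabs simp: eval_fps_at_0 G_def g_def)
  then have "\<forall>\<^sub>F x in at 0. g / 2 < \<bar>eval_fps G x\<bar> \<and> \<bar>eval_fps G x\<bar> < 2 * g"
    using g by (intro eventually_conj order_tendstoD) auto
  then obtain \<delta>1 where \<delta>1: "\<delta>1 > 0" "\<And>x. x \<noteq> 0 \<Longrightarrow> \<bar>x\<bar> < \<delta>1 \<Longrightarrow> g / 2 < \<bar>eval_fps G x\<bar> \<and> \<bar>eval_fps G x\<bar> < 2 * g"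
    unfolding eventually_at by (auto simp: dist_real_def)
  obtain \<delta>2 where \<delta>2: "\<delta>2 > 0" "ereal \<delta>2 < fps_conv_radius E"
    using ereal_dense2[OF assms(1)] by auto
  have "g / 2 * x ^ M \<le> \<bar>eval_fps E x\<bar> \<and> \<bar>eval_fps E x\<bar> \<le> 2 * g * x ^ M"
    if "0 < x" "x < min \<delta>1 \<delta>2" for x
  proof -
    have "ereal (norm x) < fps_conv_radius E" using that \<delta>2 by (auto intro: less_trans[of _ "ereal \<delta>2"])
    then have "eval_fps G x = eval_fps E x / x ^ M" using that unfolding G_def
      by (subst eval_fps_shift) (auto simp: M_def)
    then have "\<bar>eval_fps E x\<bar> = \<bar>eval_fps G x\<bar> * x ^ M" using that by (simp add: abs_mult)
    moreover have "g / 2 < \<bar>eval_fps G x\<bar>" "\<bar>eval_fps G x\<bar> < 2 * g" using \<delta>1(2)[of x] that by auto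
    moreover have "x ^ M > 0" using that by simp
    ultimately show ?thesis by (simp add: mult_right_mono)
  qed
  then show ?thesis unfolding M_def[symmetric] using \<delta>1(1) \<delta>2(1) g
    by (intro exI[of _ "min \<delta>1 \<delta>2"] conjI exI[of _ "g / 2"] exI[of _ "2 * g"]) auto
qed

section \<open>Evaluation of the series inside the unit disc\<close>

context mahler_signs
begin

definition fr :: "real fps" where "fr = fps_of_int_fps f"

definition F :: "real \<Rightarrow> real" where "F = eval_fps fr"

lemma fr_nth: "fps_nth fr n = of_int (c n)"
  by (simp add: fr_def)

lemma radius_fr: "fps_conv_radius fr \<ge> 1"
  unfolding fps_conv_radius_def
proof (rule conv_radius_geI_ex')
  fix r :: real assume r: "0 < r" "ereal r < 1"
  show "summable (\<lambda>n. fps_nth fr n * of_real r ^ n)"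
  proof (rule summable_comparison_test[where g = "\<lambda>n. r ^ n"])
    have "norm (fps_nth fr n * of_real r ^ n) \<le> r ^ n" for n
      using c_sign[of n] r by (auto simp: fr_nth)
    then show "\<exists>N. \<forall>n\<ge>N. norm (fps_nth fr n * of_real r ^ n) \<le> r ^ n" by blast
    show "summable (\<lambda>n. r ^ n)" using r by (intro summable_geometric) auto
  qed
qed

lemma less_radius_fr: "\<bar>x :: real\<bar> < 1 \<Longrightarrow> ereal (norm x) < fps_conv_radius fr"
  using radius_fr by (metis ereal_less(3) less_le_trans real_norm_def)

lemma less_radius_fr_power: "\<bar>x :: real\<bar> < 1 \<Longrightarrow> ereal (norm x) < fps_conv_radius (fr ^ n)"
  using less_radius_fr fps_conv_radius_power[of fr n] by (rule less_le_trans)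

lemma less_radius_poly_mult:
  assumes "\<bar>x :: real\<bar> < 1"
  shows "ereal (norm x) < fps_conv_radius (fps_of_poly q * fr ^ n)"
proof (rule less_le_trans)
  show "ereal (norm x) < min (fps_conv_radius (fps_of_poly q)) (fps_conv_radius (fr ^ n))"
    using less_radius_fr_power[OF assms] by simp
qed (rule fps_conv_radius_mult)

lemma eval_relation:
  fixes r :: "nat \<Rightarrow> int poly"
  assumes "\<bar>x\<bar> < 1"
  shows "ereal (norm x) < fps_conv_radius (fps_of_int_fps (\<Sum>j\<le>N. fps_of_poly (r j) * f ^ j) :: real fps)" (is ?A)
    and "eval_fps (fps_of_int_fps (\<Sum>j\<le>N. fps_of_poly (r j) * f ^ j)) x =
     (\<Sum>j\<le>N. poly (map_poly of_int (r j)) x * F x ^ j)" (is ?B)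
proof -
  have eq: "fps_of_int_fps (\<Sum>j\<le>N. fps_of_poly (r j) * f ^ j) =
      (\<Sum>j\<le>N. fps_of_poly (map_poly of_int (r j)) * fr ^ j)" for N
    by (simp add: fps_of_int_fps_sum fps_of_int_fps_mult fps_of_int_fps_power fr_def fps_of_int_fps_of_poly)
  have ev: "eval_fps (fps_of_poly q * fr ^ j) x = poly q x * F x ^ j" for q j
    using less_radius_fr_power[OF assms] less_radius_fr[OF assms]
    by (simp add: eval_fps_mult eval_fps_power F_def)
  have "?A \<and> ?B"
    unfolding eq
  proof (induction N)
    case 0
    show ?case using ev[of _ 0] less_radius_poly_mult[OF assms, of _ 0] by simp
  next
    case (Suc N)
    define s where "s = (\<Sum>j\<le>N. fps_of_poly (map_poly of_int (r j)) * fr ^ j)"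
    define t where "t = fps_of_poly (map_poly of_int (r (Suc N))) * fr ^ Suc N"
    have t: "ereal (norm x) < fps_conv_radius t" unfolding t_def by (rule less_radius_poly_mult[OF assms])
    have s: "ereal (norm x) < fps_conv_radius s" using Suc by (simp add: s_def)
    have "ereal (norm x) < min (fps_conv_radius s) (fps_conv_radius t)" using s t by simp
    then have "ereal (norm x) < fps_conv_radius (s + t)" using fps_conv_radius_add by (rule less_le_trans)
    moreover have "eval_fps (s + t) x = eval_fps s x + poly (map_poly of_int (r (Suc N))) x * F x ^ Suc N"
      unfolding eval_fps_add[OF s t] by (simp only: t_def ev)
    ultimately show ?case using Suc unfolding s_def t_def by simp
  qed
  then show ?A ?B by auto
qed

lemma F_0: "F 0 = 1"
  by (simp add: F_def eval_fps_at_0 fr_nth)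

lemma F_tendsto: "(X \<longlonglongrightarrow> 0) \<Longrightarrow> (\<lambda>k. F (X k)) \<longlonglongrightarrow> 1"
proof -
  assume X: "X \<longlonglongrightarrow> 0"
  have "isCont F 0" unfolding F_def by (rule continuous_eval_fps) (use less_radius_fr[of 0] in simp)
  then show "(\<lambda>k. F (X k)) \<longlonglongrightarrow> 1" using isCont_tendsto_compose[OF _ X, of F] F_0 by simp
qed

lemma P_fun_eq: "P_fun p v x = poly (map_poly of_int P) x"
proof -
  define q where "q = map_poly real_of_int P"
  have q: "coeff q i = (if i < p then of_int (v i) else 0)" for i
    by (simp add: q_def coeff_map_poly coeff_P)
  have "poly q x = (\<Sum>i\<le>degree q. coeff q i * x ^ i)" by (rule poly_altdef)
  also have "\<dots> = (\<Sum>i<p. coeff q i * x ^ i)"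
  proof (rule sum.mono_neutral_cong)
    show "coeff q i * x ^ i = 0" if "i \<in> {..<p} - {..degree q}" for i
      using that by (simp add: coeff_eq_0)
    show "coeff q i * x ^ i = 0" if "i \<in> {..degree q} - {..<p}" for i
      using that by (simp add: q)
  qed simp_all
  finally show ?thesis by (simp add: P_fun_def q flip: q_def)
qed

text \<open>The series of \<open>F (x ^ p)\<close> is that of \<open>F\<close> spread over the
  multiples of \<open>p\<close>. Summing it by reindexing gives both its value and a radius of
  convergence of at least 1, as needed to evaluate the product in
  \<open>f_functional\<close>.\<close>

lemma F_functional:
  assumes "\<bar>x\<bar> < 1"
  shows "F x = P_fun p v x * F (x ^ p)"
proof -
  define g where "g = fr oo fps_X ^ p"
  have gn: "fps_nth g n = (if p dvd n then fps_nth fr (n div p) else 0)" for n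
    by (simp add: g_def fps_nth_compose_X_power)
  have gs: "(\<lambda>n. fps_nth g n * y ^ n) sums F (y ^ p)" if "\<bar>y\<bar> < 1" for y
  proof -
    have yp: "\<bar>y ^ p\<bar> < 1" using that p3 by (simp add: power_abs power_less_one_iff)
    have "(\<lambda>n. fps_nth fr n * (y ^ p) ^ n) sums F (y ^ p)"
      unfolding F_def by (rule sums_eval_fps[OF less_radius_fr[OF yp]])
    then have "(\<lambda>n. fps_nth g (p * n) * y ^ (p * n)) sums F (y ^ p)"
      using p3 by (simp add: gn power_mult)
    then show ?thesis
      by (subst (asm) sums_mono_reindex[where g = "\<lambda>n. p * n" and f = "\<lambda>n. fps_nth g n * y ^ n"])
         (use p3 in \<open>auto simp: strict_mono_def gn elim!: dvdE\<close>)
  qed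
  have "fps_conv_radius g \<ge> 1"
    unfolding fps_conv_radius_def
  proof (rule conv_radius_geI_ex')
    fix r :: real assume "0 < r" "ereal r < 1"
    then show "summable (\<lambda>n. fps_nth g n * of_real r ^ n)"
      using gs[of r] by (auto simp: sums_iff)
  qed
  then have rg: "ereal (norm x) < fps_conv_radius g"
    using assms by (metis ereal_less(3) less_le_trans real_norm_def)
  have "fr = fps_of_poly (map_poly of_int P) * g"
    unfolding fr_def g_def
    by (subst f_functional) (simp add: fps_of_int_fps_mult fps_of_int_fps_compose_X_power fps_of_int_fps_of_poly)
  then have "F x = eval_fps (fps_of_poly (map_poly of_int P) * g) x" by (simp add: F_def)
  also have "\<dots> = P_fun p v x * eval_fps g x"
    using rg by (simp add: eval_fps_mult P_fun_eq)
  also have "eval_fps g x = F (x ^ p)" using gs[OF assms] by (simp add: eval_fps_def sums_iff)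
  finally show ?thesis .
qed

end

section \<open>The value at \<open>1/b\<close> and its partial products\<close>

locale mahler_value = mahler_signs +
  fixes b :: int
  assumes b2: "b \<ge> 2"
    and P_nonzero_at: "\<And>i::nat. P_fun p v (1 / of_int b ^ (p ^ i)) \<noteq> 0"
begin

definition X :: "nat \<Rightarrow> int" where "X k = b ^ (p ^ k)"

definition \<xi> :: real where "\<xi> = F (1 / of_int b)"

definition Pk :: "nat \<Rightarrow> real" where "Pk k = (\<Prod>i<k. P_fun p v (1 / of_int (X i)))"

lemma X_ge: "X k > int k" "X k \<ge> 2"
proof -
  have "int k < 2 ^ k" by (rule of_nat_less_two_power)
  also have "(2 :: int) ^ k \<le> 2 ^ (p ^ k)"
    using p3 less_exp[of k] power_mono[of 2 p k] by (intro power_increasing) auto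
  also have "\<dots> \<le> X k" unfolding X_def using b2 by (intro power_mono) auto
  finally show "X k > int k" .
  have "(2 :: int) ^ 1 \<le> 2 ^ (p ^ k)" using p3 by (intro power_increasing) auto
  also have "\<dots> \<le> X k" unfolding X_def using b2 by (intro power_mono) auto
  finally show "X k \<ge> 2" by simp
qed

lemma X_Suc: "X (Suc k) = X k ^ p"
  by (simp add: X_def mult.commute flip: power_mult)

lemma X_lim: "(\<lambda>k. 1 / real_of_int (X k)) \<longlonglongrightarrow> 0"
proof (rule tendsto_sandwich[of "\<lambda>_. 0" _ _ "\<lambda>k. 1 / real k"])
  show "\<forall>\<^sub>F k in sequentially. 1 / real_of_int (X k) \<le> 1 / real k"
  proof (rule eventually_sequentiallyI[of 1])
    fix k :: nat assume "1 \<le> k"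
    moreover have "real k \<le> real_of_int (X k)" using X_ge(1)[of k] by linarith
    ultimately show "1 / real_of_int (X k) \<le> 1 / real k" by (intro divide_left_mono) auto
  qed
  show "\<forall>\<^sub>F k in sequentially. 0 \<le> 1 / real_of_int (X k)"
    using X_ge(2) by (intro always_eventually allI) (smt (verit) of_int_nonneg zero_le_divide_1_iff)
qed (auto intro: lim_1_over_n)

lemma X_inverse_bounds: "0 < 1 / real_of_int (X k)" "1 / real_of_int (X k) < 1"
  using X_ge(2)[of k] by auto

lemma xi_eq: "\<xi> = Pk k * F (1 / of_int (X k))"
proof (induction k)
  case 0
  show ?case by (simp add: \<xi>_def Pk_def X_def)
next
  case (Suc k)
  have "F (1 / of_int (X k)) = P_fun p v (1 / of_int (X k)) * F ((1 / of_int (X k)) ^ p)"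
    using X_inverse_bounds[of k] by (intro F_functional) auto
  also have "(1 / of_int (X k)) ^ p = 1 / real_of_int (X (Suc k))" by (simp add: X_Suc power_one_over)
  finally show ?case using Suc by (simp add: Pk_def)
qed

lemma Pk_nonzero: "Pk k \<noteq> 0"
  using P_nonzero_at by (simp add: Pk_def X_def)

text \<open>The first \<open>k\<close> factors multiply to a polynomial in \<open>1/b\<close> of
  degree \<open>(p - 1) * (1 + p + ... + p ^ (k - 1))\<close>, which is less than
  \<open>p ^ k\<close>; so \<open>X k\<close> clears the denominators.\<close>

lemma Pk_int: "\<exists>g :: int. Pk k * of_int (X k) = of_int g"
proof (induction k)
  case 0
  show ?case by (simp add: Pk_def)
next
  case (Suc k)
  then obtain g where g: "Pk k * of_int (X k) = of_int g" by blast
  have Xk: "real_of_int (X k) \<noteq> 0" using X_ge(2)[of k] by simp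
  have "P_fun p v (1 / of_int (X k)) * of_int (X k) ^ (p - 1) = (\<Sum>i<p. real_of_int (v i * X k ^ (p - 1 - i)))"
    unfolding P_fun_def sum_distrib_right
  proof (intro sum.cong refl)
    fix i assume "i \<in> {..<p}"
    then have "p - 1 = i + (p - 1 - i)" by auto
    then have "real_of_int (X k) ^ (p - 1) = real_of_int (X k) ^ i * real_of_int (X k) ^ (p - 1 - i)"
      by (metis power_add)
    then show "real_of_int (v i) * (1 / real_of_int (X k)) ^ i * real_of_int (X k) ^ (p - 1) =
         real_of_int (v i * X k ^ (p - 1 - i))"
      using Xk by (simp add: power_one_over)
  qed
  moreover have "Pk (Suc k) * of_int (X (Suc k)) =
     (Pk k * of_int (X k)) * (P_fun p v (1 / of_int (X k)) * of_int (X k) ^ (p - 1))"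
  proof -
    have "p = Suc (p - 1)" using p3 by simp
    then have "real_of_int (X (Suc k)) = of_int (X k) * of_int (X k) ^ (p - 1)"
      unfolding X_Suc of_int_power by (metis power_Suc)
    then show ?thesis by (simp add: Pk_def)
  qed
  ultimately have "Pk (Suc k) * of_int (X (Suc k)) = of_int (g * (\<Sum>i<p. v i * X k ^ (p - 1 - i)))"
    using g by simp
  then show ?case by blast
qed

lemma F_lim: "(\<lambda>k. F (1 / of_int (X k))) \<longlonglongrightarrow> 1"
  by (rule F_tendsto[OF X_lim])

text \<open>The partial products are nonzero, so a zero value would force every tail
  \<open>F (1 / of_int (X k))\<close> to be 0, whereas the tails tend to 1.\<close>

lemma xi_nonzero: "\<xi> \<noteq> 0"
proof
  assume "\<xi> = 0"
  then have "F (1 / of_int (X k)) = 0" for k using xi_eq[of k] Pk_nonzero[of k] by simp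
  then have "(\<lambda>k. 0 :: real) \<longlonglongrightarrow> 1" using F_lim by simp
  then show False using LIMSEQ_unique[OF _ tendsto_const[of "0 :: real"]] by fastforce
qed

lemma Pk_lim: "Pk \<longlonglongrightarrow> \<xi>"
proof -
  have "F (1 / of_int (X k)) \<noteq> 0" for k using xi_eq[of k] xi_nonzero by auto
  then have "Pk = (\<lambda>k. \<xi> / F (1 / of_int (X k)))" using xi_eq by (auto simp: fun_eq_iff field_simps)
  moreover have "(\<lambda>k. \<xi> / F (1 / of_int (X k))) \<longlonglongrightarrow> \<xi> / 1"
    using F_lim by (intro tendsto_intros) auto
  ultimately show ?thesis by simp
qed

lemma Pk_bounds: "\<exists>C\<ge>1. \<forall>k. \<bar>Pk k\<bar> \<le> C" "\<forall>\<^sub>F k in sequentially. \<bar>\<xi>\<bar> / 2 < \<bar>Pk k\<bar>"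
proof -
  have "Bseq Pk" by (rule convergent_imp_Bseq[OF convergentI[OF Pk_lim]])
  then obtain K where "\<And>k. norm (Pk k) \<le> K" unfolding Bseq_def by blast
  then show "\<exists>C\<ge>1. \<forall>k. \<bar>Pk k\<bar> \<le> C" by (intro exI[of _ "max 1 K"]) (auto simp: le_max_iff_disj)
  show "\<forall>\<^sub>F k in sequentially. \<bar>\<xi>\<bar> / 2 < \<bar>Pk k\<bar>"
    using tendsto_rabs[OF Pk_lim] xi_nonzero by (intro order_tendstoD) auto
qed

text \<open>Convergence of an infinite product includes a nonzero limit; \<open>xi_nonzero\<close>
  provides it.\<close>

lemma f_prod_eq_xi: "f_prod p v (1 / of_int b) = \<xi>"
proof -
  have "(\<lambda>n. \<Prod>i\<le>n. P_fun p v ((1 / of_int b) ^ (p ^ i))) = (\<lambda>n. Pk (Suc n))"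
    by (simp add: Pk_def X_def power_one_over lessThan_Suc_atMost)
  moreover have "(\<lambda>n. Pk (Suc n)) \<longlonglongrightarrow> \<xi>" using Pk_lim by (rule LIMSEQ_Suc)
  ultimately have "raw_has_prod (\<lambda>i. P_fun p v ((1 / of_int b) ^ (p ^ i))) 0 \<xi>"
    using xi_nonzero by (simp add: raw_has_prod_def)
  then have "(\<lambda>i. P_fun p v ((1 / of_int b) ^ (p ^ i))) has_prod \<xi>" by (simp add: has_prod_def)
  then show ?thesis unfolding f_prod_def by (metis has_prod_unique)
qed

end

lemma poly_scaled_int:
  fixes q :: "int poly" and Y :: int
  assumes "degree q \<le> N" "Y \<noteq> 0"
  shows "poly (map_poly of_int q) (1 / real_of_int Y) * of_int Y ^ N = of_int (\<Sum>i\<le>N. coeff q i * Y ^ (N - i))"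
proof -
  have "poly (map_poly of_int q) (1 / real_of_int Y) = (\<Sum>i\<le>degree q. of_int (coeff q i) * (1 / real_of_int Y) ^ i)"
    by (simp add: poly_altdef coeff_map_poly degree_map_poly)
  also have "\<dots> = (\<Sum>i\<le>N. of_int (coeff q i) * (1 / real_of_int Y) ^ i)"
    using assms(1) by (intro sum.mono_neutral_left) (auto simp: coeff_eq_0)
  also have "\<dots> * of_int Y ^ N = (\<Sum>i\<le>N. real_of_int (coeff q i * Y ^ (N - i)))"
    unfolding sum_distrib_right
  proof (intro sum.cong refl)
    fix i assume "i \<in> {..N}"
    then have "real_of_int Y ^ N = of_int Y ^ i * of_int Y ^ (N - i)" by (simp flip: power_add)
    then show "of_int (coeff q i) * (1 / real_of_int Y) ^ i * of_int Y ^ N = real_of_int (coeff q i * Y ^ (N - i))"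
      using assms(2) by (simp add: power_one_over)
  qed
  finally show ?thesis by simp
qed

lemma poly_scaled_bound:
  fixes q :: "int poly" and Y :: int
  assumes "Y \<ge> 1"
  shows "\<bar>\<Sum>i\<le>N. coeff q i * Y ^ (N - i)\<bar> \<le> (\<Sum>i\<le>N. \<bar>coeff q i\<bar>) * Y ^ N"
proof -
  have "\<bar>\<Sum>i\<le>N. coeff q i * Y ^ (N - i)\<bar> \<le> (\<Sum>i\<le>N. \<bar>coeff q i * Y ^ (N - i)\<bar>)" by (rule sum_abs)
  also have "\<dots> \<le> (\<Sum>i\<le>N. \<bar>coeff q i\<bar> * Y ^ N)"
    unfolding abs_mult using assms by (intro sum_mono mult_left_mono) (auto intro: power_increasing)
  finally show ?thesis by (simp add: sum_distrib_right)
qed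

section \<open>The auxiliary function and Mahler's method\<close>

context mahler_signs
begin

text \<open>There are \<open>(N + 1)\<^sup>2\<close> free coefficients against
  \<open>N\<^sup>2\<close> vanishing conditions; \<open>f_transcendental\<close> guarantees that the
  resulting series is not 0.\<close>

lemma auxiliary_relation:
  "\<exists>r :: nat \<Rightarrow> int poly. (\<forall>j. degree (r j) \<le> N) \<and> (\<Sum>j\<le>N. fps_of_poly (r j) * f ^ j) \<noteq> 0 \<and>
     N\<^sup>2 \<le> subdegree (\<Sum>j\<le>N. fps_of_poly (r j) * f ^ j)"
proof -
  define J where "J = {..N} \<times> {..N}"
  define a :: "nat \<Rightarrow> nat \<times> nat \<Rightarrow> int" where "a = (\<lambda>t (i, j). fps_nth (fps_X ^ i * f ^ j) t)"
  define H where "H = 1 + (\<Sum>t<N\<^sup>2. \<Sum>ij\<in>J. \<bar>a t ij\<bar>)"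
  have Hb: "\<bar>a t ij\<bar> \<le> H" if "t \<in> {..<N\<^sup>2}" "ij \<in> J" for t ij
  proof -
    have "\<bar>a t ij\<bar> \<le> (\<Sum>ij\<in>J. \<bar>a t ij\<bar>)"
      using that by (intro member_le_sum) (auto simp: J_def)
    also have "\<dots> \<le> (\<Sum>t<N\<^sup>2. \<Sum>ij\<in>J. \<bar>a t ij\<bar>)"
      using that by (intro member_le_sum[of t "{..<N\<^sup>2}" "\<lambda>t. \<Sum>ij\<in>J. \<bar>a t ij\<bar>"]) (auto intro!: sum_nonneg)
    finally show ?thesis by (simp add: H_def)
  qed
  have "\<exists>x. (\<exists>ij\<in>J. x ij \<noteq> 0) \<and> (\<forall>ij\<in>J. \<bar>x ij\<bar> \<le> (2 * int (card J) * H) ^ (3 ^ card {..<N\<^sup>2})) \<and>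
             (\<forall>t\<in>{..<N\<^sup>2}. (\<Sum>ij\<in>J. a t ij * x ij) = 0)"
  proof (rule homogeneous_system)
    show "card {..<N\<^sup>2} < card J" by (simp add: J_def power2_eq_square)
    show "1 \<le> H" unfolding H_def by (simp add: sum_nonneg)
  qed (use Hb in \<open>auto simp: J_def\<close>)
  then obtain x where x: "\<exists>ij\<in>J. x ij \<noteq> 0" "\<And>t. t < N\<^sup>2 \<Longrightarrow> (\<Sum>ij\<in>J. a t ij * x ij) = 0" by blast
  define r :: "nat \<Rightarrow> int poly" where "r = (\<lambda>j. \<Sum>i\<le>N. monom (x (i, j)) i)"
  define E where "E = (\<Sum>j\<le>N. fps_of_poly (r j) * f ^ j)"
  have cr: "coeff (r j) i = (if i \<le> N then x (i, j) else 0)" for i j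
  proof -
    have "coeff (r j) i = (\<Sum>k\<le>N. if k = i then x (k, j) else 0)" by (simp add: r_def coeff_sum)
    then show ?thesis by simp
  qed
  have deg: "degree (r j) \<le> N" for j by (rule degree_le) (simp add: cr)
  obtain i j where ij: "i \<le> N" "j \<le> N" "x (i, j) \<noteq> 0" using x(1) by (auto simp: J_def)
  have E0: "E \<noteq> 0"
  proof
    assume "E = 0"
    then have "r j = 0" unfolding E_def using ij(2) by (rule f_transcendental)
    then show False using cr[of j i] ij by simp
  qed
  have "fps_nth E t = 0" if "t < N\<^sup>2" for t
  proof -
    have "E = (\<Sum>j\<le>N. \<Sum>i\<le>N. fps_const (x (i, j)) * (fps_X ^ i * f ^ j))"
      by (simp add: E_def r_def fps_of_poly_sum fps_of_poly_monom sum_distrib_right mult.assoc)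
    also have "\<dots> = (\<Sum>i\<le>N. \<Sum>j\<le>N. fps_const (x (i, j)) * (fps_X ^ i * f ^ j))" by (rule sum.swap)
    also have "\<dots> = (\<Sum>(i, j)\<in>J. fps_const (x (i, j)) * (fps_X ^ i * f ^ j))"
      by (simp add: J_def sum.cartesian_product)
    finally have "fps_nth E t = (\<Sum>ij\<in>J. a t ij * x ij)"
      by (simp add: fps_sum_nth a_def case_prod_unfold mult.commute del: fps_X_power_mult_nth)
    then show ?thesis using x(2)[OF that] by simp
  qed
  then have "N\<^sup>2 \<le> subdegree E" using E0 by (intro subdegree_geI) auto
  then show ?thesis using deg E0 unfolding E_def by blast
qed

end

context mahler_value
begin

lemma eventually_X_inverse_less: "\<delta> > 0 \<Longrightarrow> \<forall>\<^sub>F k in sequentially. 1 / real_of_int (X k) < \<delta>"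
  using X_lim by (rule order_tendstoD)

lemma eventually_X_greater: "\<forall>\<^sub>F k in sequentially. C < real_of_int (X k)"
proof -
  obtain n :: nat where "C < real n" using reals_Archimedean2 by blast
  then show ?thesis using X_ge(1) by (intro eventually_sequentiallyI[of n]) (smt (verit) of_int_of_nat_eq of_int_less_iff of_nat_mono)
qed

text \<open>The auxiliary function at \<open>1 / X k\<close>, with denominators cleared, is an
  integer polynomial in \<open>\<xi>\<close>. It is nonzero for large \<open>k\<close>, but too
  small for \<open>algebraic_lower_bound\<close>.\<close>

lemma xi_transcendental: "\<not> algebraic \<xi>"
proof
  assume "algebraic \<xi>"
  then obtain \<kappa> where \<kappa>: "\<And>N. \<exists>C>0. \<forall>(t :: nat \<Rightarrow> int) (H :: int). H \<ge> 1 \<longrightarrow> (\<forall>k\<le>N. \<bar>t k\<bar> \<le> H) \<longrightarrow>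
    (\<Sum>k\<le>N. t k * \<xi> ^ k) \<noteq> 0 \<longrightarrow> 1 \<le> C * real_of_int H ^ \<kappa> * \<bar>\<Sum>k\<le>N. t k * \<xi> ^ k\<bar>"
    using algebraic_lower_bound by blast
  \<comment> \<open>With \<open>Y = X k\<close>, coefficients of size \<open>Y ^ (2 * N)\<close> and
    a value of size \<open>Y\<close> to the power \<open>2 * N - N\<^sup>2\<close> give the exponent
    \<open>2 * N * \<kappa> + 2 * N - N\<^sup>2\<close> in the Liouville inequality. This choice
    makes it \<open>-N\<close>.\<close>
  define N where "N = 2 * \<kappa> + 3"
  obtain C where C: "C > 0" "\<And>(t :: nat \<Rightarrow> int) (H :: int). H \<ge> 1 \<Longrightarrow> \<forall>k\<le>N. \<bar>t k\<bar> \<le> H \<Longrightarrow>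
    (\<Sum>k\<le>N. t k * \<xi> ^ k) \<noteq> 0 \<Longrightarrow> 1 \<le> C * real_of_int H ^ \<kappa> * \<bar>\<Sum>k\<le>N. t k * \<xi> ^ k\<bar>"
    using \<kappa>[of N] by blast
  obtain r :: "nat \<Rightarrow> int poly" where deg: "\<And>j. degree (r j) \<le> N"
    and E0: "(\<Sum>j\<le>N. fps_of_poly (r j) * f ^ j) \<noteq> 0"
    and sub: "N\<^sup>2 \<le> subdegree (\<Sum>j\<le>N. fps_of_poly (r j) * f ^ j)"
    using auxiliary_relation[of N] by blast
  define E where "E = (\<Sum>j\<le>N. fps_of_poly (r j) * f ^ j)"
  define Er :: "real fps" where "Er = fps_of_int_fps E"
  have Er0: "Er \<noteq> 0"
  proof
    assume "Er = 0"
    then have "real_of_int (fps_nth E n) = 0" for n by (metis Er_def fps_nth_of_int_fps fps_zero_nth)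
    then show False using E0 by (auto simp: E_def fps_eq_iff)
  qed
  have "fps_nth Er n = 0" if "n < N\<^sup>2" for n
    using that sub unfolding Er_def E_def by (auto intro: nth_less_subdegree_zero)
  then have subr: "N\<^sup>2 \<le> subdegree Er" using Er0 by (intro subdegree_geI) auto
  have rad: "fps_conv_radius Er > 0"
    using eval_relation(1)[where x = 0 and N = N and r = r] by (simp add: Er_def E_def zero_ereal_def)
  obtain \<delta> c1 c2 where \<delta>: "\<delta> > 0" "c1 > 0" "c2 > 0"
    and Eb: "\<And>x. 0 < x \<Longrightarrow> x < \<delta> \<Longrightarrow> c1 * x ^ subdegree Er \<le> \<bar>eval_fps Er x\<bar> \<and> \<bar>eval_fps Er x\<bar> \<le> c2 * x ^ subdegree Er"
    using eval_fps_subdegree_bounds[OF rad Er0] by blast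
  obtain C1 where C1: "C1 \<ge> 1" "\<And>k. \<bar>Pk k\<bar> \<le> C1" using Pk_bounds(1) by blast
  define S where "S = (\<Sum>j\<le>N. \<Sum>i\<le>N. \<bar>coeff (r j) i\<bar>)"
  define K where "K = (S + 1) * \<lceil>C1\<rceil> ^ N"
  define C' where "C' = C * real_of_int K ^ \<kappa> * (c2 * C1 ^ N)"
  have C1c: "\<lceil>C1\<rceil> \<ge> 1" "C1 \<le> real_of_int \<lceil>C1\<rceil>" using C1(1) by linarith+
  have S0: "S \<ge> 0" unfolding S_def by (intro sum_nonneg) auto
  have K1: "K \<ge> 1" unfolding K_def using C1c S0 mult_mono[of 1 "S + 1" 1 "\<lceil>C1\<rceil> ^ N"] by simp
  have "\<forall>\<^sub>F k in sequentially. False"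
    using eventually_X_inverse_less[OF \<delta>(1)] eventually_X_greater[of C']
  proof eventually_elim
    case (elim k)
    define Y where "Y = X k"
    have Y: "Y \<ge> 2" using X_ge(2) by (simp add: Y_def)
    define x where "x = 1 / real_of_int Y"
    have x: "0 < x" "x < 1" "x < \<delta>" using X_inverse_bounds[of k] elim by (auto simp: x_def Y_def)
    obtain g where g: "Pk k * of_int Y = of_int g" using Pk_int[of k] by (auto simp: Y_def)
    have xiF: "\<xi> = Pk k * F x" using xi_eq[of k] by (simp add: x_def Y_def)
    \<comment> \<open>These are the integer coefficients after multiplication by
      \<open>Y ^ N * g ^ N\<close>, because \<open>F x\<close> is
      \<open>Y * \<xi> / g\<close>.\<close>
    define t where "t = (\<lambda>j. (\<Sum>i\<le>N. coeff (r j) i * Y ^ (N - i)) * (g ^ (N - j) * Y ^ j))"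
    have Yr: "real_of_int Y > 0" using Y by simp
    have "(\<Sum>j\<le>N. t j * \<xi> ^ j) = (\<Sum>j\<le>N. poly (map_poly of_int (r j)) x * F x ^ j) * (of_int Y ^ N * of_int g ^ N)"
      unfolding sum_distrib_right
    proof (intro sum.cong refl)
      fix j assume "j \<in> {..N}"
      then have gN: "real_of_int g ^ N = of_int g ^ (N - j) * of_int g ^ j" by (simp flip: power_add)
      have "of_int (t j) * \<xi> ^ j = (poly (map_poly of_int (r j)) x * of_int Y ^ N) * (of_int g ^ (N - j) * of_int Y ^ j) * \<xi> ^ j"
        using poly_scaled_int[where Y = Y and N = N and q = "r j"] deg[of j] Y by (simp add: t_def x_def)
      also have "of_int Y ^ j * \<xi> ^ j = of_int g ^ j * F x ^ j"
        unfolding xiF g[symmetric] by (simp add: power_mult_distrib mult_ac)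
      then have "(poly (map_poly of_int (r j)) x * of_int Y ^ N) * (of_int g ^ (N - j) * of_int Y ^ j) * \<xi> ^ j
          = (poly (map_poly of_int (r j)) x * of_int Y ^ N) * of_int g ^ (N - j) * (of_int g ^ j * F x ^ j)"
        by (simp add: mult.assoc)
      finally show "of_int (t j) * \<xi> ^ j = poly (map_poly of_int (r j)) x * F x ^ j * (of_int Y ^ N * of_int g ^ N)"
        unfolding gN by (simp add: mult_ac)
    qed
    also have "(\<Sum>j\<le>N. poly (map_poly of_int (r j)) x * F x ^ j) = eval_fps Er x"
      using eval_relation(2)[where x = x and N = N and r = r] x by (simp add: Er_def E_def)
    finally have T: "(\<Sum>j\<le>N. t j * \<xi> ^ j) = eval_fps Er x * (of_int Y ^ N * of_int g ^ N)" .
    have g0: "g \<noteq> 0" using g Pk_nonzero[of k] Yr by auto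
    have gb: "\<bar>real_of_int g\<bar> \<le> C1 * of_int Y"
      unfolding g[symmetric] abs_mult using C1(2)[of k] Yr by (intro mult_mono) auto
    have gb': "\<bar>g\<bar> \<le> \<lceil>C1\<rceil> * Y"
    proof -
      have "C1 * real_of_int Y \<le> of_int \<lceil>C1\<rceil> * of_int Y" using C1c Yr by (intro mult_right_mono) auto
      then have "real_of_int \<bar>g\<bar> \<le> real_of_int \<lceil>C1\<rceil> * of_int Y" using gb by simp
      then show ?thesis by (metis of_int_le_iff of_int_mult)
    qed
    define H where "H = K * Y ^ (2 * N)"
    have H1: "H \<ge> 1" unfolding H_def using K1 Y mult_mono[of 1 K 1 "Y ^ (2 * N)"] by simp
    have tb: "\<bar>t j\<bar> \<le> H" if "j \<le> N" for j
    proof -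
      have "\<bar>t j\<bar> = \<bar>\<Sum>i\<le>N. coeff (r j) i * Y ^ (N - i)\<bar> * (\<bar>g\<bar> ^ (N - j) * Y ^ j)"
        using Y by (simp add: t_def abs_mult power_abs)
      also have "\<dots> \<le> ((S + 1) * Y ^ N) * (\<lceil>C1\<rceil> ^ N * Y ^ N)"
      proof (rule mult_mono)
        have "(\<Sum>i\<le>N. \<bar>coeff (r j) i\<bar>) \<le> S" unfolding S_def
          using that by (intro member_le_sum[of j "{..N}" "\<lambda>j. \<Sum>i\<le>N. \<bar>coeff (r j) i\<bar>"]) (auto intro!: sum_nonneg)
        then have "(\<Sum>i\<le>N. \<bar>coeff (r j) i\<bar>) * Y ^ N \<le> (S + 1) * Y ^ N" using Y by (intro mult_right_mono) auto
        then show "\<bar>\<Sum>i\<le>N. coeff (r j) i * Y ^ (N - i)\<bar> \<le> (S + 1) * Y ^ N"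
          using poly_scaled_bound[where Y = Y and N = N and q = "r j"] Y by linarith
        have "\<bar>g\<bar> ^ (N - j) * Y ^ j \<le> (\<lceil>C1\<rceil> * Y) ^ (N - j) * Y ^ j"
          using gb' Y by (intro mult_right_mono power_mono) auto
        also have "\<dots> = \<lceil>C1\<rceil> ^ (N - j) * Y ^ N"
          using that by (simp add: power_mult_distrib flip: power_add)
        also have "\<dots> \<le> \<lceil>C1\<rceil> ^ N * Y ^ N"
          using C1c Y by (intro mult_right_mono power_increasing) auto
        finally show "\<bar>g\<bar> ^ (N - j) * Y ^ j \<le> \<lceil>C1\<rceil> ^ N * Y ^ N" .
      qed (use S0 Y in auto)
      also have "\<dots> = H" unfolding H_def K_def mult_2 power_add by (simp only: mult_ac)
      finally show ?thesis .
    qed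
    have "0 < c1 * x ^ subdegree Er" using x \<delta> by simp
    then have "eval_fps Er x \<noteq> 0" using Eb[OF x(1,3)] by auto
    then have "(\<Sum>j\<le>N. t j * \<xi> ^ j) \<noteq> 0" unfolding T using g0 Yr by simp
    then have one: "1 \<le> C * real_of_int H ^ \<kappa> * \<bar>\<Sum>j\<le>N. t j * \<xi> ^ j\<bar>"
      using H1 tb by (intro C(2)) auto
    have "\<bar>\<Sum>j\<le>N. t j * \<xi> ^ j\<bar> \<le> (c2 * x ^ N\<^sup>2) * (of_int Y ^ N * (C1 * of_int Y) ^ N)" (is "_ \<le> ?R")
      unfolding T abs_mult power_abs
    proof (intro mult_mono power_mono gb)
      have "\<bar>eval_fps Er x\<bar> \<le> c2 * x ^ subdegree Er" using Eb[OF x(1,3)] by simp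
      also have "\<dots> \<le> c2 * x ^ N\<^sup>2" using x \<delta> subr by (intro mult_left_mono power_decreasing) auto
      finally show "\<bar>eval_fps Er x\<bar> \<le> c2 * x ^ N\<^sup>2" .
    qed (use Yr x \<delta> C1 in auto)
    then have "C * real_of_int H ^ \<kappa> * \<bar>\<Sum>j\<le>N. t j * \<xi> ^ j\<bar> \<le> C * real_of_int H ^ \<kappa> * ?R"
      using C(1) H1 by (intro mult_left_mono) auto
    also have "\<dots> = C' * (of_int Y ^ (2 * N * \<kappa> + 2 * N) * x ^ N\<^sup>2)"
    proof -
      have "real_of_int H ^ \<kappa> = of_int K ^ \<kappa> * of_int Y ^ (2 * N * \<kappa>)"
        by (simp add: H_def power_mult_distrib power_mult)
      moreover have "of_int Y ^ N * (C1 * of_int Y) ^ N = C1 ^ N * of_int Y ^ (2 * N)"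
        by (simp add: power_mult_distrib mult_2 power_add)
      ultimately show ?thesis unfolding C'_def by (simp only: power_add mult_ac)
    qed
    finally have le: "1 \<le> C' * (of_int Y ^ (2 * N * \<kappa> + 2 * N) * x ^ N\<^sup>2)" using one by linarith
    define m where "m = 2 * N * \<kappa> + 2 * N"
    have "N\<^sup>2 = m + N" by (simp add: m_def N_def power2_eq_square algebra_simps)
    then have "x ^ N\<^sup>2 = x ^ m * x ^ N" by (simp only: power_add)
    then have "of_int Y ^ m * x ^ N\<^sup>2 = (of_int Y * x) ^ m * x ^ N" by (simp add: power_mult_distrib)
    also have "of_int Y * x = 1" using Yr by (simp add: x_def)
    finally have "of_int Y ^ (2 * N * \<kappa> + 2 * N) * x ^ N\<^sup>2 = x ^ N" by (simp add: m_def)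
    also have "x ^ N \<le> x ^ 1" using x by (intro power_decreasing) (auto simp: N_def)
    finally have le2: "of_int Y ^ (2 * N * \<kappa> + 2 * N) * x ^ N\<^sup>2 \<le> x" by simp
    have "C' > 0" unfolding C'_def using C(1) K1 \<delta> C1 by simp
    then have "C' * (of_int Y ^ (2 * N * \<kappa> + 2 * N) * x ^ N\<^sup>2) \<le> C' * x" using le2 by (intro mult_left_mono) auto
    then have "1 \<le> C' * x" using le by linarith
    then have "real_of_int Y \<le> C'" using Yr by (simp add: x_def field_simps)
    then show False using elim by (simp add: Y_def)
  qed
  then show False by simp
qed

end

section \<open>Irrationality exponent\<close>

text \<open>Dirichlet's theorem in the form \<open>rational_iff_finite_approx_set\<close>, with the
  positive integer denominators moved to the naturals.\<close>

lemma infinite_approximations_of_irrational: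
  fixes \<xi> :: real
  assumes "\<xi> \<notin> \<rat>"
  shows "infinite {(r :: int, s :: nat). s > 0 \<and> \<bar>\<xi> - of_int r / of_nat s\<bar> < of_nat s powr (- 2)}"
    (is "infinite ?A")
proof
  assume "finite ?A"
  moreover have "approx_set \<xi> \<subseteq> (\<lambda>(r, s). (r, int s)) ` ?A"
  proof
    fix z assume "z \<in> approx_set \<xi>"
    then obtain h k where z: "z = (h, k)" "k > 0" "\<bar>\<xi> - of_int h / of_int k\<bar> < 1 / (of_int k)\<^sup>2"
      by (auto simp: approx_set_def)
    have "of_nat (nat k) powr (- 2) = 1 / (real_of_int k)\<^sup>2"
      using z(2) by (simp add: powr_minus_divide powr_numeral)
    then have "(h, nat k) \<in> ?A" using z by simp
    moreover have "z = (\<lambda>(r, s). (r, int s)) (h, nat k)" using z by simp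
    ultimately show "z \<in> (\<lambda>(r, s). (r, int s)) ` ?A" by (rule rev_image_eqI)
  qed
  ultimately have "finite (approx_set \<xi>)" by (auto intro: finite_subset)
  then show False using assms rational_iff_finite_approx_set by simp
qed

lemma irrationality_exponent_eq_2I:
  assumes "\<xi> \<notin> \<rat>"
    and "\<And>\<nu>. \<nu> > 2 \<Longrightarrow> finite {(r :: int, s :: nat). s > 0 \<and> \<bar>\<xi> - of_int r / of_nat s\<bar> < of_nat s powr (- \<nu>)}"
  shows "irrationality_exponent \<xi> = 2"
proof (rule antisym)
  show "irrationality_exponent \<xi> \<le> 2"
    unfolding irrationality_exponent_def
  proof (rule Sup_least)
    fix y assume "y \<in> {ereal \<nu> | \<nu>. infinite {(r :: int, s :: nat). s > 0 \<and> \<bar>\<xi> - of_int r / of_nat s\<bar> < of_nat s powr (- \<nu>)}}"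
    then obtain \<nu> where "y = ereal \<nu>"
      "infinite {(r :: int, s :: nat). s > 0 \<and> \<bar>\<xi> - of_int r / of_nat s\<bar> < of_nat s powr (- \<nu>)}" by blast
    moreover from this have "\<nu> \<le> 2" using assms(2)[of \<nu>] by (meson not_le)
    ultimately show "y \<le> 2" by (simp add: numeral_eq_ereal)
  qed
  have "ereal 2 \<le> irrationality_exponent \<xi>"
    unfolding irrationality_exponent_def
    using infinite_approximations_of_irrational[OF assms(1)] by (intro Sup_upper) blast
  then show "2 \<le> irrationality_exponent \<xi>" by (simp add: numeral_eq_ereal)
qed

text \<open>A bound on \<open>s\<close> also bounds \<open>r\<close>, because \<open>r / s\<close>
  lies within distance 1 of \<open>\<xi>\<close>.\<close>

lemma finite_approximations:
  fixes \<xi> \<nu> :: real and s0 :: nat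
  assumes "\<nu> \<ge> 0"
    and "\<And>r s. s \<ge> s0 \<Longrightarrow> s > 0 \<Longrightarrow> of_nat s powr (- \<nu>) \<le> \<bar>\<xi> - of_int r / of_nat s\<bar>"
  shows "finite {(r :: int, s :: nat). s > 0 \<and> \<bar>\<xi> - of_int r / of_nat s\<bar> < of_nat s powr (- \<nu>)}"
proof (rule finite_subset)
  define B where "B = \<lceil>real s0 * (\<bar>\<xi>\<bar> + 1)\<rceil>"
  show "{(r :: int, s :: nat). s > 0 \<and> \<bar>\<xi> - of_int r / of_nat s\<bar> < of_nat s powr (- \<nu>)} \<subseteq> {-B..B} \<times> {..s0}"
  proof
    fix z :: "int \<times> nat"
    assume "z \<in> {(r, s). s > 0 \<and> \<bar>\<xi> - of_int r / of_nat s\<bar> < of_nat s powr (- \<nu>)}"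
    then obtain r s where z: "z = (r, s)" and s: "s > 0"
      and lt: "\<bar>\<xi> - of_int r / of_nat s\<bar> < of_nat s powr (- \<nu>)" by blast
    have ss: "s \<le> s0" using assms(2)[of s r] s lt by linarith
    have "of_nat s powr (- \<nu>) \<le> 1" using s assms(1) by (simp add: powr_minus_divide ge_one_powr_ge_zero)
    then have "\<bar>real_of_int r / real s\<bar> \<le> \<bar>\<xi>\<bar> + 1" using lt by linarith
    then have "\<bar>real_of_int r\<bar> \<le> real s * (\<bar>\<xi>\<bar> + 1)" using s by (simp add: field_simps)
    also have "\<dots> \<le> real s0 * (\<bar>\<xi>\<bar> + 1)" using ss by (intro mult_right_mono) auto
    finally have "\<bar>real_of_int r\<bar> \<le> B" unfolding B_def by linarith
    then have "\<bar>r\<bar> \<le> B" by linarith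
    then show "z \<in> {-B..B} \<times> {..s0}" using ss z by auto
  qed
qed auto

section \<open>Pade approximants of the series\<close>

context mahler_signs
begin

text \<open>The \<open>n + 1\<close> coefficients of \<open>q\<close> are subject to
  \<open>n\<close> conditions, in degrees \<open>n + 1\<close> to \<open>2 * n\<close>;
  \<open>r\<close> is the truncation of \<open>q * f\<close>. The upper bound on the order is
  \<open>badly_approximable\<close>.\<close>

lemma pade:
  "\<exists>q r :: int poly. degree q \<le> n \<and> degree r \<le> n \<and> fps_of_poly q * f - fps_of_poly r \<noteq> 0 \<and>
     2 * n + 1 \<le> subdegree (fps_of_poly q * f - fps_of_poly r) \<and>
     subdegree (fps_of_poly q * f - fps_of_poly r) \<le> 2 * n + 4"
proof -
  have "\<exists>x. (\<exists>j\<in>{..n}. x j \<noteq> 0) \<and> (\<forall>j\<in>{..n}. \<bar>x j\<bar> \<le> (2 * int (Suc n) * 1) ^ 3 ^ card {n<..2 * n}) \<and>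
      (\<forall>t\<in>{n<..2 * n}. (\<Sum>j\<in>{..n}. c (t - j) * x j) = 0)"
  proof (rule homogeneous_system)
    show "\<bar>c (t - j)\<bar> \<le> 1" for t j using c_sign[of "t - j"] by auto
  qed auto
  then obtain x where x: "\<exists>j\<le>n. x j \<noteq> 0" "\<And>t. n < t \<Longrightarrow> t \<le> 2 * n \<Longrightarrow> (\<Sum>j\<in>{..n}. c (t - j) * x j) = 0"
    by (metis atMost_iff greaterThanAtMost_iff)
  define q where "q = (\<Sum>i\<le>n. monom (x i) i)"
  have cq: "coeff q i = (if i \<le> n then x i else 0)" for i
  proof -
    have "coeff q i = (\<Sum>k\<le>n. if k = i then x k else 0)" by (simp add: q_def coeff_sum)
    then show ?thesis by simp
  qed
  define r where "r = (\<Sum>i\<le>n. monom (fps_nth (fps_of_poly q * f) i) i)"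
  have cr: "coeff r i = (if i \<le> n then fps_nth (fps_of_poly q * f) i else 0)" for i
  proof -
    have "coeff r i = (\<Sum>k\<le>n. if k = i then fps_nth (fps_of_poly q * f) k else 0)" by (simp add: r_def coeff_sum)
    then show ?thesis by simp
  qed
  define E where "E = fps_of_poly q * f - fps_of_poly r"
  have En: "fps_nth E i = (if i \<le> n then 0 else fps_nth (fps_of_poly q * f) i)" for i
    by (simp add: E_def cr)
  have small: "fps_nth E i = 0" if "i < 2 * n + 1" for i
  proof (cases "i \<le> n")
    case False
    have "fps_nth E i = (\<Sum>j\<in>{0..i}. coeff q j * c (i - j))" using False by (simp add: En fps_mult_nth)
    also have "\<dots> = (\<Sum>j\<le>n. c (i - j) * x j)"
      using False by (intro sum.mono_neutral_cong_right) (auto simp: cq)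
    also have "\<dots> = 0" using False that by (intro x(2)) auto
    finally show ?thesis .
  qed (simp add: En)
  have "\<exists>i. n < i \<and> i < 2 * n + 5 \<and> fps_nth (fps_of_poly q * f) i \<noteq> 0"
  proof (rule ccontr)
    assume "\<not> ?thesis"
    then have "fps_of_poly q = 0" by (intro badly_approximable[of n]) (auto simp: cq)
    then have "coeff q j = 0" for j by (metis fps_of_poly_nth fps_zero_nth)
    then show False using x(1) by (metis cq)
  qed
  then obtain i where i: "n < i" "i < 2 * n + 5" "fps_nth E i \<noteq> 0" using En by auto
  have "E \<noteq> 0" using i(3) by auto
  moreover have "2 * n + 1 \<le> subdegree E" using \<open>E \<noteq> 0\<close> small by (intro subdegree_geI) auto
  moreover have "subdegree E \<le> 2 * n + 4" using subdegree_leI[OF i(3)] i(2) by simp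
  moreover have "degree q \<le> n" "degree r \<le> n" by (auto intro!: degree_le simp: cq cr)
  ultimately show ?thesis unfolding E_def by blast
qed

end

section \<open>Rational approximations of the value\<close>

context mahler_value
begin

text \<open>A Pade remainder at \<open>1 / Y\<close>, where \<open>Y = X k\<close>, is multiplied by
  \<open>Y ^ (n + 1) * Pk k\<close>, which turns it into \<open>S * \<xi> - R\<close> with integers
  \<open>S\<close> and \<open>R\<close>. The remainder has order between \<open>2 * n + 1\<close>
  and \<open>2 * n + 4\<close>, hence the two bounds that differ by a factor of order
  \<open>Y ^ 3\<close>.\<close>

lemma good_approximations:
  "\<exists>c>0. \<exists>C>0. \<forall>\<^sub>F k in sequentially. \<exists>S R :: int. \<bar>real_of_int S\<bar> \<le> C * of_int (X k) ^ (n + 1) \<and>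
     c / of_int (X k) ^ (n + 3) \<le> \<bar>S * \<xi> - R\<bar> \<and> \<bar>S * \<xi> - R\<bar> \<le> C / of_int (X k) ^ n"
proof -
  obtain q r where deg: "degree q \<le> n" "degree r \<le> n" and E0: "fps_of_poly q * f - fps_of_poly r \<noteq> 0"
    and sub: "2 * n + 1 \<le> subdegree (fps_of_poly q * f - fps_of_poly r)"
      "subdegree (fps_of_poly q * f - fps_of_poly r) \<le> 2 * n + 4"
    using pade[of n] by blast
  define E where "E = fps_of_poly q * f - fps_of_poly r"
  define Er :: "real fps" where "Er = fps_of_int_fps E"
  \<comment> \<open>The remainder as a relation of degree 1 in \<open>f\<close>, to which
    \<open>eval_relation\<close> applies.\<close>
  define rr where "rr = (\<lambda>j::nat. if j = 0 then - r else q)"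
  have Esum: "E = (\<Sum>j\<le>1. fps_of_poly (rr j) * f ^ j)"
    by (simp add: E_def rr_def fps_of_poly_uminus)
  have nzr: "fps_nth Er i = 0 \<longleftrightarrow> fps_nth E i = 0" for i by (simp add: Er_def)
  have Er0: "Er \<noteq> 0" using E0 nzr unfolding E_def[symmetric] by (metis fps_nonzero_nth)
  have "subdegree Er = subdegree E"
    using E0 Er0 nzr unfolding E_def[symmetric] by (intro subdegreeI) (auto simp: nzr intro: nth_less_subdegree_zero)
  then have subr: "2 * n + 1 \<le> subdegree Er" "subdegree Er \<le> 2 * n + 4" using sub by (simp_all add: E_def)
  have rad: "fps_conv_radius Er > 0"
    using eval_relation(1)[where x = 0 and N = 1 and r = rr] by (simp add: Er_def Esum zero_ereal_def)
  have ev: "eval_fps Er x = poly (map_poly of_int q) x * F x - poly (map_poly of_int r) x" if "\<bar>x\<bar> < 1" for x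
  proof -
    have "map_poly real_of_int (- r) = - map_poly real_of_int r"
      by (rule poly_eqI) (simp add: coeff_map_poly)
    then show ?thesis
      using eval_relation(2)[where x = x and N = 1 and r = rr] that by (simp add: Er_def Esum rr_def)
  qed
  obtain \<delta> c1 c2 where \<delta>: "\<delta> > 0" "c1 > 0" "c2 > 0"
    and Eb: "\<And>x. 0 < x \<Longrightarrow> x < \<delta> \<Longrightarrow> c1 * x ^ subdegree Er \<le> \<bar>eval_fps Er x\<bar> \<and> \<bar>eval_fps Er x\<bar> \<le> c2 * x ^ subdegree Er"
    using eval_fps_subdegree_bounds[OF rad Er0] by blast
  obtain C1 where C1: "C1 \<ge> 1" "\<And>k. \<bar>Pk k\<bar> \<le> C1" using Pk_bounds(1) by blast
  define K where "K = real_of_int (\<Sum>i\<le>n. \<bar>coeff q i\<bar>)"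
  have K0: "K \<ge> 0" unfolding K_def by (simp add: sum_nonneg)
  define cc where "cc = \<bar>\<xi>\<bar> / 2 * c1"
  \<comment> \<open>One constant for two bounds: \<open>K\<close> serves the size of
    \<open>S\<close>, and \<open>C1 * c2\<close> the size of the remainder.\<close>
  define C where "C = K + C1 * c2"
  have "cc > 0" "C > 0" unfolding cc_def C_def using \<delta> C1 K0 xi_nonzero by (auto intro: add_nonneg_pos)
  moreover have "\<forall>\<^sub>F k in sequentially. \<exists>S R :: int. \<bar>real_of_int S\<bar> \<le> C * of_int (X k) ^ (n + 1) \<and>
     cc / of_int (X k) ^ (n + 3) \<le> \<bar>S * \<xi> - R\<bar> \<and> \<bar>S * \<xi> - R\<bar> \<le> C / of_int (X k) ^ n"
    using eventually_X_inverse_less[OF \<delta>(1)] Pk_bounds(2)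
  proof eventually_elim
    case (elim k)
    define Y where "Y = X k"
    have Y: "Y \<ge> 2" using X_ge(2) by (simp add: Y_def)
    then have Yr: "real_of_int Y > 0" "real_of_int Y \<ge> 1" by auto
    define x where "x = 1 / real_of_int Y"
    have x: "0 < x" "x < 1" "x < \<delta>" using X_inverse_bounds[of k] elim by (auto simp: x_def Y_def)
    obtain g where g: "Pk k * of_int Y = of_int g" using Pk_int[of k] by (auto simp: Y_def)
    have xiF: "\<xi> = Pk k * F x" using xi_eq[of k] by (simp add: x_def Y_def)
    define S where "S = (\<Sum>i\<le>n. coeff q i * Y ^ (n - i)) * Y"
    define R where "R = (\<Sum>i\<le>n. coeff r i * Y ^ (n - i)) * g"
    have S: "real_of_int S = poly (map_poly of_int q) x * of_int Y ^ n * of_int Y"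
      using poly_scaled_int[where q = q and N = n and Y = Y] deg Y by (simp add: S_def x_def)
    have R: "real_of_int R = poly (map_poly of_int r) x * of_int Y ^ n * (Pk k * of_int Y)"
      unfolding g using poly_scaled_int[where q = r and N = n and Y = Y] deg Y by (simp add: R_def x_def)
    have "S * \<xi> - R = of_int Y ^ (n + 1) * Pk k * eval_fps Er x"
    proof -
      have "eval_fps Er x = poly (map_poly of_int q) x * F x - poly (map_poly of_int r) x" using x by (intro ev) auto
      then show ?thesis unfolding S R xiF by (simp only:) (simp add: algebra_simps)
    qed
    then have SR: "\<bar>S * \<xi> - R\<bar> = of_int Y ^ (n + 1) * (\<bar>Pk k\<bar> * \<bar>eval_fps Er x\<bar>)"
      using Yr by (simp add: abs_mult)
    have "\<bar>S\<bar> = \<bar>\<Sum>i\<le>n. coeff q i * Y ^ (n - i)\<bar> * Y" using Y by (simp add: S_def abs_mult)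
    also have "\<dots> \<le> ((\<Sum>i\<le>n. \<bar>coeff q i\<bar>) * Y ^ n) * Y"
      using poly_scaled_bound[where q = q and N = n and Y = Y] Y by (intro mult_right_mono) auto
    finally have "real_of_int \<bar>S\<bar> \<le> real_of_int (((\<Sum>i\<le>n. \<bar>coeff q i\<bar>) * Y ^ n) * Y)" by (simp only: of_int_le_iff)
    then have "\<bar>real_of_int S\<bar> \<le> K * of_int Y ^ (n + 1)" by (simp add: K_def mult_ac)
    also have "\<dots> \<le> C * of_int Y ^ (n + 1)" unfolding C_def using C1 \<delta> Yr by (intro mult_right_mono) auto
    finally have 1: "\<bar>real_of_int S\<bar> \<le> C * of_int Y ^ (n + 1)" .
    have Yx: "of_int Y ^ (n + 1) * x ^ (n + 1 + m) = 1 / of_int Y ^ m" for m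
      using Yr by (simp add: x_def power_add power_one_over)
    have "\<bar>S * \<xi> - R\<bar> \<le> of_int Y ^ (n + 1) * (C1 * (c2 * x ^ (n + 1 + n)))"
      unfolding SR
    proof (intro mult_left_mono mult_mono)
      have "\<bar>eval_fps Er x\<bar> \<le> c2 * x ^ subdegree Er" using Eb x by blast
      also have "\<dots> \<le> c2 * x ^ (n + 1 + n)" using x \<delta> subr by (intro mult_left_mono power_decreasing) auto
      finally show "\<bar>eval_fps Er x\<bar> \<le> c2 * x ^ (n + 1 + n)" .
    qed (use C1 Yr in auto)
    also have "\<dots> = (C1 * c2) * (of_int Y ^ (n + 1) * x ^ (n + 1 + n))" by (simp only: mult_ac)
    also have "\<dots> = (C1 * c2) / of_int Y ^ n" unfolding Yx by simp
    also have "\<dots> \<le> C / of_int Y ^ n" unfolding C_def using K0 Yr by (intro divide_right_mono) auto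
    finally have 2: "\<bar>S * \<xi> - R\<bar> \<le> C / of_int Y ^ n" .
    have "cc / of_int Y ^ (n + 3) = cc * (of_int Y ^ (n + 1) * x ^ (n + 1 + (n + 3)))"
      unfolding Yx by simp
    also have "\<dots> = of_int Y ^ (n + 1) * (\<bar>\<xi>\<bar> / 2 * (c1 * x ^ (n + 1 + (n + 3))))" unfolding cc_def by (simp only: mult_ac)
    also have "\<dots> \<le> \<bar>S * \<xi> - R\<bar>"
      unfolding SR
    proof (intro mult_left_mono mult_mono)
      have "c1 * x ^ (n + 1 + (n + 3)) \<le> c1 * x ^ subdegree Er" using x \<delta> subr by (intro mult_left_mono power_decreasing) auto
      also have "\<dots> \<le> \<bar>eval_fps Er x\<bar>" using Eb x by blast
      finally show "c1 * x ^ (n + 1 + (n + 3)) \<le> \<bar>eval_fps Er x\<bar>" .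
    qed (use elim \<delta> x Yr in auto)
    finally have 3: "cc / of_int Y ^ (n + 3) \<le> \<bar>S * \<xi> - R\<bar>" .
    show ?case using 1 2 3 unfolding Y_def by blast
  qed
  ultimately show ?thesis by blast
qed

lemma finite_good_approximations:
  assumes "\<nu> > 2"
  shows "finite {(r :: int, s :: nat). s > 0 \<and> \<bar>\<xi> - of_int r / of_nat s\<bar> < of_nat s powr (- \<nu>)}"
proof -
  \<comment> \<open>This makes \<open>\<tau> = 2 + 6 / N\<close> smaller than \<open>\<nu>\<close>.
    The 6 is the loss in \<open>2 * n + 4 = 2 * (n - 1) + 6\<close>, and \<open>N\<close> bounds its
    relative weight.\<close>
  obtain N :: nat where N: "6 / (\<nu> - 2) < real N" using reals_Archimedean2 by blast
  have "0 < 6 / (\<nu> - 2)" using assms by simp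
  then have N0: "N > 0" using N by (cases N) auto
  define \<tau> where "\<tau> = 2 + 6 / real N"
  have \<tau>: "\<tau> < \<nu>" "\<tau> > 0" using N N0 assms by (auto simp: \<tau>_def field_simps add_pos_nonneg)
  have "\<forall>n. \<exists>c C k0. c > 0 \<and> C > 0 \<and> (\<forall>k\<ge>k0. \<exists>S R :: int. \<bar>real_of_int S\<bar> \<le> C * of_int (X k) ^ (n + 1) \<and>
     c / of_int (X k) ^ (n + 3) \<le> \<bar>S * \<xi> - R\<bar> \<and> \<bar>S * \<xi> - R\<bar> \<le> C / of_int (X k) ^ n)"
    using good_approximations unfolding eventually_sequentially by blast
  then obtain c C k0 where c: "\<And>n. c n > (0 :: real)" and C: "\<And>n. C n > (0 :: real)"
    and app: "\<And>n k. k0 n \<le> k \<Longrightarrow> \<exists>S R :: int. \<bar>real_of_int S\<bar> \<le> C n * of_int (X k) ^ (n + 1) \<and>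
     c n / of_int (X k) ^ (n + 3) \<le> \<bar>S * \<xi> - R\<bar> \<and> \<bar>S * \<xi> - R\<bar> \<le> C n / of_int (X k) ^ n"
    by metis
  \<comment> \<open>Only the indices \<open>n\<close> in this finite range occur, so the constants
    can be made uniform while \<open>k\<close> grows.\<close>
  define I where "I = {..p * N}"
  have I: "finite I" "I \<noteq> {}" by (auto simp: I_def)
  define cm where "cm = Min (c ` I)"
  define Cm where "Cm = Max (C ` I)"
  define km where "km = Max (k0 ` I)"
  have cm: "cm > 0" using c I by (simp add: cm_def)
  have Cm: "Cm > 0" using C I by (auto simp: Cm_def Max_gr_iff)
  have bounds: "cm \<le> c n" "C n \<le> Cm" "k0 n \<le> km" if "n \<in> I" for n
    using that I by (auto simp: cm_def Cm_def km_def)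
  define c2 where "c2 = min 1 (cm / Cm)"
  have c2: "c2 > 0" "c2 \<le> 1" "c2 \<le> cm / Cm" using cm Cm by (auto simp: c2_def)
  have main: "c2 * (2 * Cm * real s) powr (- \<tau>) \<le> \<bar>\<xi> - of_int r / of_nat s\<bar>"
    if s: "s > 0" and big: "of_int (X km) ^ N \<le> 2 * Cm * real s" for r :: int and s :: nat
  proof -
    \<comment> \<open>Choose \<open>k\<close>, then \<open>n\<close>, with \<open>Y ^ (n - 1) \<le> A < Y ^ n\<close> and \<open>N < n \<le> p N\<close>: a denominator of size
      \<open>Y ^ (n + 1)\<close> that exceeds \<open>s\<close> by little.\<close>
    define A where "A = 2 * Cm * real s"
    have A0: "A > 0" using Cm s by (simp add: A_def)
    define K where "K = {k. real_of_int (X k) ^ N \<le> A}"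
    have "K \<subseteq> {..nat \<lceil>A\<rceil>}"
    proof
      fix k assume "k \<in> K"
      have "real k \<le> real_of_int (X k)" using X_ge(1)[of k] by linarith
      also have "\<dots> \<le> real_of_int (X k) ^ N" using X_ge(2)[of k] N0 by (intro self_le_power) auto
      also have "\<dots> \<le> A" using \<open>k \<in> K\<close> by (simp add: K_def)
      finally show "k \<in> {..nat \<lceil>A\<rceil>}" by simp linarith
    qed
    then have finK: "finite K" by (rule finite_subset) simp
    have kmK: "km \<in> K" using big by (simp add: K_def A_def)
    define k where "k = Max K"
    have kK: "k \<in> K" unfolding k_def using finK kmK by (intro Max_in) auto
    have "km \<le> k" unfolding k_def using finK kmK by (rule Max_ge)
    have "Suc k \<notin> K"
    proof
      assume "Suc k \<in> K"
      then have "Suc k \<le> k" unfolding k_def using finK by (intro Max_ge)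
      then show False by simp
    qed
    define Y where "Y = real_of_int (X k)"
    have Y1: "Y > 1" using X_ge(2)[of k] by (simp add: Y_def)
    have YN: "Y ^ N \<le> A" using kK by (simp add: K_def Y_def)
    have YpN: "A < Y ^ (p * N)" using \<open>Suc k \<notin> K\<close> by (simp add: K_def Y_def X_Suc power_mult)
    define n where "n = (LEAST n. A < Y ^ n)"
    have An: "A < Y ^ n" unfolding n_def using YpN by (rule LeastI)
    have npN: "n \<le> p * N" unfolding n_def using YpN by (rule Least_le)
    have Nn: "N < n"
    proof (rule ccontr)
      assume "\<not> N < n"
      then have "Y ^ n \<le> Y ^ N" using Y1 by (intro power_increasing) auto
      then show False using An YN by linarith
    qed
    have n1: "Y ^ (n - 1) \<le> A"
      using not_less_Least[of "n - 1" "\<lambda>n. A < Y ^ n"] Nn unfolding n_def[symmetric] by simp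
    have nI: "n \<in> I" using npN by (simp add: I_def)
    obtain S R :: int where S: "\<bar>real_of_int S\<bar> \<le> C n * Y ^ (n + 1)"
      and lo: "c n / Y ^ (n + 3) \<le> \<bar>S * \<xi> - R\<bar>" and up: "\<bar>S * \<xi> - R\<bar> \<le> C n / Y ^ n"
      using app[of n k] bounds(3)[OF nI] \<open>km \<le> k\<close> unfolding Y_def by auto
    have pos: "Y ^ m > 0" for m using Y1 by simp
    have "C n * Y ^ (n + 1) \<le> Cm * Y ^ (n + 1)" using bounds(2)[OF nI] Y1 by (intro mult_right_mono) auto
    with S have S: "\<bar>real_of_int S\<bar> \<le> Cm * Y ^ (n + 1)" by linarith
    have "cm / Y ^ (n + 3) \<le> c n / Y ^ (n + 3)" using bounds(1)[OF nI] Y1 by (intro divide_right_mono) auto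
    with lo have lo: "cm / Y ^ (n + 3) \<le> \<bar>S * \<xi> - R\<bar>" by linarith
    have "C n / Y ^ n \<le> Cm / Y ^ n" using bounds(2)[OF nI] Y1 by (intro divide_right_mono) auto
    with up have up: "\<bar>S * \<xi> - R\<bar> \<le> Cm / Y ^ n" by linarith
    \<comment> \<open>The factor 2 in \<open>A\<close> leaves half of the integer gap in the case of
      distinct fractions below.\<close>
    have sup: "real s * \<bar>S * \<xi> - R\<bar> \<le> 1 / 2"
    proof -
      have "real s * \<bar>S * \<xi> - R\<bar> \<le> real s * (Cm / Y ^ n)" using up by (intro mult_left_mono) auto
      also have "\<dots> = A / Y ^ n / 2" by (simp add: A_def)
      also have "\<dots> \<le> 1 / 2" using An pos[of n] by simp
      finally show ?thesis .
    qed
    have S0: "S \<noteq> 0"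
    proof
      assume "S = 0"
      then have "real s * \<bar>real_of_int R\<bar> \<le> 1 / 2" using sup by simp
      moreover have "1 * \<bar>real_of_int R\<bar> \<le> real s * \<bar>real_of_int R\<bar>" using s by (intro mult_right_mono) auto
      ultimately have "R = 0" by linarith
      then have "cm / Y ^ (n + 3) \<le> 0" using lo \<open>S = 0\<close> by simp
      then show False using cm pos[of "n + 3"] by (simp add: divide_le_0_iff)
    qed
    have "c2 / Y ^ (2 * n + 4) \<le> \<bar>\<xi> - of_int r / of_nat s\<bar>"
    \<comment> \<open>If \<open>r / s\<close> equals \<open>R / S\<close>, the lower bound for
      \<open>S * \<xi> - R\<close> applies. Otherwise \<open>s * R - r * S\<close> is a nonzero
      integer, and \<open>sup\<close> shows that the remainder cannot compensate for more than half
      of it.\<close>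
    proof (cases "r * S = int s * R")
      case True
      then have "real_of_int r * of_int S = real s * of_int R" by (metis of_int_mult of_int_of_nat_eq)
      then have R: "real_of_int R = of_int r / real s * of_int S" using s by (simp add: field_simps)
      have "\<bar>S * \<xi> - R\<bar> = \<bar>\<xi> - of_int r / of_nat s\<bar> * \<bar>real_of_int S\<bar>"
        unfolding R by (simp add: algebra_simps flip: abs_mult)
      also have "\<dots> \<le> \<bar>\<xi> - of_int r / of_nat s\<bar> * (Cm * Y ^ (n + 1))" using S by (intro mult_left_mono) auto
      finally have "cm / Y ^ (n + 3) \<le> \<bar>\<xi> - of_int r / of_nat s\<bar> * (Cm * Y ^ (n + 1))" using lo by linarith
      then have "cm / Y ^ (n + 3) / (Cm * Y ^ (n + 1)) \<le> \<bar>\<xi> - of_int r / of_nat s\<bar>"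
        using Cm pos[of "n + 1"] by (simp only: pos_divide_le_eq mult_pos_pos)
      moreover have "cm / Y ^ (n + 3) / (Cm * Y ^ (n + 1)) = cm / Cm / Y ^ (2 * n + 4)"
      proof -
        have "2 * n + 4 = (n + 3) + (n + 1)" by simp
        then have "Y ^ (2 * n + 4) = Y ^ (n + 3) * Y ^ (n + 1)" by (simp only: power_add)
        then show ?thesis by (simp only: divide_divide_eq_left mult_ac)
      qed
      moreover have "c2 / Y ^ (2 * n + 4) \<le> cm / Cm / Y ^ (2 * n + 4)"
        using c2(3) Y1 by (intro divide_right_mono) auto
      ultimately show ?thesis by linarith
    next
      case False
      then have "\<bar>int s * R - r * S\<bar> \<ge> 1" by linarith
      then have "\<bar>real s * of_int R - of_int r * of_int S\<bar> \<ge> 1"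
        by (metis of_int_1_le_iff of_int_abs of_int_diff of_int_mult of_int_of_nat_eq)
      moreover have "\<bar>real s * (S * \<xi> - R)\<bar> \<le> 1 / 2" using sup by (simp add: abs_mult)
      moreover have "real s * of_int S * (\<xi> - of_int r / of_nat s)
          = real s * (S * \<xi> - R) + (real s * of_int R - of_int r * of_int S)"
        using s by (simp add: field_simps)
      ultimately have "1 / 2 \<le> \<bar>real s * of_int S * (\<xi> - of_int r / of_nat s)\<bar>" by linarith
      also have "\<dots> = \<bar>\<xi> - of_int r / of_nat s\<bar> * (real s * \<bar>real_of_int S\<bar>)" by (simp add: abs_mult)
      also have "\<dots> \<le> \<bar>\<xi> - of_int r / of_nat s\<bar> * (real s * (Cm * Y ^ (n + 1)))"
        using S by (intro mult_left_mono) auto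
      also have "\<dots> = \<bar>\<xi> - of_int r / of_nat s\<bar> * (A / 2 * Y ^ (n + 1))" by (simp add: A_def)
      also have "\<dots> \<le> \<bar>\<xi> - of_int r / of_nat s\<bar> * (Y ^ n / 2 * Y ^ (n + 1))"
        using An Y1 by (intro mult_left_mono mult_right_mono) auto
      also have "\<dots> = \<bar>\<xi> - of_int r / of_nat s\<bar> * Y ^ (2 * n + 1) / 2"
      proof -
        have "2 * n + 1 = n + (n + 1)" by simp
        then have "Y ^ (2 * n + 1) = Y ^ n * Y ^ (n + 1)" by (simp only: power_add)
        then show ?thesis by (simp only: times_divide_eq_left times_divide_eq_right mult_ac)
      qed
      finally have "1 \<le> \<bar>\<xi> - of_int r / of_nat s\<bar> * Y ^ (2 * n + 1)" by simp
      also have "\<dots> \<le> \<bar>\<xi> - of_int r / of_nat s\<bar> * Y ^ (2 * n + 4)"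
        using Y1 by (intro mult_left_mono power_increasing) auto
      finally have "c2 \<le> \<bar>\<xi> - of_int r / of_nat s\<bar> * Y ^ (2 * n + 4)" using c2(2) by linarith
      then show ?thesis using pos[of "2 * n + 4"] by (simp only: pos_divide_le_eq)
    qed
    moreover have "A powr (- \<tau>) \<le> 1 / Y ^ (2 * n + 4)"
    proof -
      \<comment> \<open>The power \<open>Y ^ (n - 1)\<close> is at most \<open>A\<close>, and
        \<open>Y ^ 6\<close> is at most \<open>A powr (6 / N)\<close> because \<open>Y ^ N\<close>
        is at most \<open>A\<close>.\<close>
      have "2 * n + 4 = (n - 1) * 2 + 6" using Nn by simp
      then have "Y ^ (2 * n + 4) = (Y ^ (n - 1)) ^ 2 * Y ^ 6" by (simp only: power_add power_mult)
      also have "\<dots> \<le> A ^ 2 * A powr (6 / real N)"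
      proof (intro mult_mono power_mono n1)
        have "Y ^ 6 = Y powr (real N * (6 / real N))" using Y1 N0 by (simp add: powr_numeral)
        also have "\<dots> = (Y ^ N) powr (6 / real N)" using Y1 by (subst powr_powr[symmetric]) (simp add: powr_realpow)
        also have "\<dots> \<le> A powr (6 / real N)" using YN pos[of N] by (intro powr_mono2) auto
        finally show "Y ^ 6 \<le> A powr (6 / real N)" .
      qed (use Y1 A0 in auto)
      also have "\<dots> = A powr \<tau>" using A0 by (simp add: \<tau>_def powr_add powr_numeral)
      finally have "Y ^ (2 * n + 4) \<le> A powr \<tau>" .
      then have "1 / A powr \<tau> \<le> 1 / Y ^ (2 * n + 4)" using pos[of "2 * n + 4"] A0 by (intro divide_left_mono) auto
      then show ?thesis by (simp add: powr_minus_divide)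
    qed
    then have "c2 * A powr (- \<tau>) \<le> c2 / Y ^ (2 * n + 4)" using c2 by (simp add: mult_left_mono divide_inverse)
    ultimately show ?thesis unfolding A_def by linarith
  qed
  \<comment> \<open>From \<open>B\<close> on, \<open>s powr (\<nu> - \<tau>)\<close> absorbs the
    constants of \<open>main\<close>; the second term in \<open>s0\<close> ensures the size
    condition of \<open>main\<close>.\<close>
  define B where "B = ((2 * Cm) powr \<tau> / c2) powr (1 / (\<nu> - \<tau>))"
  define s0 where "s0 = nat (max \<lceil>B\<rceil> \<lceil>of_int (X km) ^ N / (2 * Cm)\<rceil>)"
  show ?thesis
  proof (rule finite_approximations[where ?s0.0 = s0])
    show "\<nu> \<ge> 0" using assms by simp
    fix r :: int and s :: nat
    assume "s0 \<le> s" and s: "s > 0"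
    then have ge: "B \<le> real s" "of_int (X km) ^ N / (2 * Cm) \<le> real s" unfolding s0_def by linarith+
    have big: "of_int (X km) ^ N \<le> 2 * Cm * real s" using ge(2) Cm by (simp add: field_simps)
    have q0: "(2 * Cm) powr \<tau> / c2 > 0" using Cm c2 by simp
    have "(2 * Cm) powr \<tau> / c2 = B powr (\<nu> - \<tau>)" using q0 \<tau> c2(1) by (simp add: B_def powr_powr)
    also have "\<dots> \<le> real s powr (\<nu> - \<tau>)" using ge(1) \<tau> by (intro powr_mono2) (auto simp: B_def)
    finally have "(2 * Cm) powr \<tau> \<le> real s powr (\<nu> - \<tau>) * c2" using c2 by (simp add: pos_divide_le_eq)
    then have "real s powr (- \<nu>) * (2 * Cm) powr \<tau> \<le> real s powr (- \<nu>) * (real s powr (\<nu> - \<tau>) * c2)"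
      by (intro mult_left_mono) auto
    also have "\<dots> = c2 * real s powr (- \<tau>)" by (simp flip: powr_add)
    finally have "real s powr (- \<nu>) \<le> c2 * real s powr (- \<tau>) / (2 * Cm) powr \<tau>"
      using Cm by (simp add: pos_le_divide_eq)
    also have "\<dots> = c2 * (2 * Cm * real s) powr (- \<tau>)"
      using Cm s by (simp add: powr_mult powr_minus_divide)
    also have "\<dots> \<le> \<bar>\<xi> - of_int r / of_nat s\<bar>" by (rule main[OF s big])
    finally show "real s powr (- \<nu>) \<le> \<bar>\<xi> - of_int r / of_nat s\<bar>" .
  qed
qed

lemma xi_irrational: "\<xi> \<notin> \<rat>"
proof
  assume "\<xi> \<in> \<rat>"
  then show False using xi_transcendental rat_imp_algebraic by blast
qed

end

theorem theorem1p3: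
  fixes p :: nat and v :: "nat \<Rightarrow> int" and b :: int
  assumes "p \<ge> 3" and "odd p"
    and "v 0 = 1"
    and "\<And>i. 1 \<le> i \<Longrightarrow> i \<le> p - 1 \<Longrightarrow> v i \<in> {-1, 1}"
    and "\<And>m. m \<ge> p \<Longrightarrow> v m = v (m mod p)"
    and "b \<ge> 2"
    and "\<And>i::nat. P_fun p v (1 / of_int b ^ (p ^ i)) \<noteq> 0"
    and "\<And>j. j \<le> p - 2 \<Longrightarrow>
           [(v j + v (j + 1) - v (2 * j + 1) - v (2 * j + 2)) div 2 = 1] (mod 2)"
  shows "\<not> algebraic (f_prod p v (1 / of_int b)) \<and>
         irrationality_exponent (f_prod p v (1 / of_int b)) = 2"
proof -
  have sign: "v i \<in> {-1, 1}" if "i < p" for i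
    using assms(3) assms(4)[of i] that by (cases "i = 0") auto
  interpret mahler_value p v b
    by unfold_locales (fact assms(1) assms(2) assms(3) sign assms(5) assms(8) assms(6) assms(7))+
  show ?thesis unfolding f_prod_eq_xi
    using xi_transcendental irrationality_exponent_eq_2I[OF xi_irrational finite_good_approximations] by simp
qed

end
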